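(* Let $M_0\in\mathbb{R}^{n\times n}$ be a symmetric diagonally dominant M-matrix (SDDM) with condition number $\kappa$ and associated weighted graph $\mathcal{G}$ on nodes $v_1,\dots,v_n$ with maximal degree $d_{\max}$, let $b_0\in\mathbb{R}^n$, let $R\ge1$ and let $\epsilon\in(0,\tfrac12]$. Put $\alpha=\min\left\{n,\frac{d_{\max}^{R+1}-1}{d_{\max}-1}\right\}$ (an upper bound on the size of the $R$-hop neighbourhood of every node). There is a decentralized algorithm $\mathcal{A}(\{[M_0]_{k1},\dots,[M_0]_{kn}\},[b_0]_k,R,\epsilon)$, in which node $v_k$ receives the $k$-th row of $M_0$, the $k$-th component of $b_0$, $R$ and $\epsilon$, that uses only $R$-hop communication between the nodes and computes an $\epsilon$-approximate solution of $M_0x=b_0$ (node $v_k$ outputting its $k$-th component) in $$\mathcal{O}\left(\left(\frac{\alpha\kappa}{R}+\alpha R\,d_{\max}\right)\log\left(\tfrac1\epsilon\right)\right)$$ time steps.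
   Context: SDDM: $M_0$ is symmetric positive definite with non-positive off-diagonal entries and $[M_0]_{ii}\ge-\sum_{j\ne i}[M_0]_{ij}$ for all $i$. Associated graph $\mathcal{G}=(\mathcal{V},\mathcal{E},W)$: nodes $v_1,\dots,v_n$, with $v_i,v_j$ ($i\neq j$) joined by an edge iff $W_{ij}:=-[M_0]_{ij}>0$. The $R$-hop neighbourhood of $v_k$ is $\mathbb{N}_R(v_k)=\{v\in\mathcal{V}:\mathrm{dist}(v_k,v)\le R\}$. Condition number: $\kappa=|\lambda_{\max}(M_0)/\lambda_{\min}(M_0)|$. $\epsilon$-approximate solution: with $x^\star$ the solution of $M_0x=b_0$, a vector $\tilde x$ with $\|x^\star-\tilde x\|_{M_0}\le\epsilon\|x^\star\|_{M_0}$, where $\|u\|_{M_0}^2=u^{\mathsf T}M_0u$. Computational model: each node of $\mathcal{G}$ is a processor with its own memory, and all nodes work in parallel. $R$-hop communication means that node $v_k$ only exchanges data with nodes in $\mathbb{N}_R(v_k)$. The number of time steps counts the arithmetic operations performed by a node.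
   Formalization: The number of communication rounds is fixed from outside as a function of κ, R and ε (nodes cannot detect stopping from their inputs); the time bound is O(max(1, ·)), which matters only when d_max = 0; for d_max = 1 the quotient in α is read as R+1. *)

theory Defs
  imports
    Complex_Main
    "HOL-Library.Extended_Nat"
    "Jordan_Normal_Form.Spectral_Radius"
begin

section \<open>SDDM matrices, condition number, approximate solutions\<close>

text \<open>Nodes and matrix indices are 0, ..., n - 1.\<close>

definition pos_def :: "nat \<Rightarrow> real mat \<Rightarrow> bool" where
  "pos_def n M \<longleftrightarrow> (\<forall>v \<in> carrier_vec n. v \<noteq> 0\<^sub>v n \<longrightarrow> v \<bullet> (M *\<^sub>v v) > 0)"

definition sddm :: "nat \<Rightarrow> real mat \<Rightarrow> bool" where
  "sddm n M \<longleftrightarrow> M \<in> carrier_mat n n \<and> transpose_mat M = M \<and> pos_def n M \<and>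
     (\<forall>i<n. \<forall>j<n. i \<noteq> j \<longrightarrow> M $$ (i, j) \<le> 0) \<and>
     (\<forall>i<n. M $$ (i, i) \<ge> - (\<Sum>j \<in> {..<n} - {i}. M $$ (i, j)))"

text \<open>The spectrum taken here is the set of real eigenvalues, which for a symmetric matrix are
  all the eigenvalues.\<close>

definition cond_num :: "real mat \<Rightarrow> real" where
  "cond_num M = \<bar>Max (spectrum M) / Min (spectrum M)\<bar>"

definition energy_norm :: "real mat \<Rightarrow> real vec \<Rightarrow> real" where
  "energy_norm M u = sqrt (u \<bullet> (M *\<^sub>v u))"

definition approx_solution :: "real mat \<Rightarrow> real vec \<Rightarrow> real \<Rightarrow> real vec \<Rightarrow> bool" where
  "approx_solution M b \<epsilon> y \<longleftrightarrow>
     (\<exists>x \<in> carrier_vec (dim_col M). M *\<^sub>v x = b \<and> energy_norm M (x - y) \<le> \<epsilon> * energy_norm M x)"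

section \<open>The associated graph\<close>

definition weight :: "real mat \<Rightarrow> nat \<Rightarrow> nat \<Rightarrow> real" where
  "weight M i j = - (M $$ (i, j))"

definition edges :: "real mat \<Rightarrow> (nat \<times> nat) set" where
  "edges M = {(i, j). i < dim_row M \<and> j < dim_row M \<and> i \<noteq> j \<and> weight M i j > 0}"

definition neighbours :: "real mat \<Rightarrow> nat \<Rightarrow> nat set" where
  "neighbours M i = {j. (i, j) \<in> edges M}"

definition max_degree :: "real mat \<Rightarrow> nat" where
  "max_degree M = Max ((\<lambda>i. card (neighbours M i)) ` {..<dim_row M})"

text \<open>The distance is infinite between different components.\<close>

definition hop_dist :: "real mat \<Rightarrow> nat \<Rightarrow> nat \<Rightarrow> enat" where
  "hop_dist M i j = (INF m \<in> {m. (i, j) \<in> edges M ^^ m}. enat m)"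

definition hop_nbhd :: "real mat \<Rightarrow> nat \<Rightarrow> nat \<Rightarrow> nat set" where
  "hop_nbhd M R k = {j. j < dim_row M \<and> hop_dist M k j \<le> enat R}"

section \<open>Computational model\<close>

text \<open>Every node is a processor with its own memory of real registers. The nodes work in
  synchronous rounds. In each round, a node executes a finite list of instructions.
  A \<open>Fetch d j s\<close> reads register \<open>s\<close> of node \<open>j\<close>, as it was at the beginning of the round,
  into the own register \<open>d\<close>; this is the only way in which data passes between nodes.
  A \<open>Test a b\<close> records whether the comparison of the two registers succeeds.\<close>

datatype reg = Row nat | Rhs | Eps | Out | Work nat

datatype arith_op = Plus | Minus | Times | Divide

datatype instr =
    Arith arith_op reg reg reg
  | Const reg int
  | Fetch reg nat reg
  | Test reg reg

text \<open>The combinatorial data known to a node: \<open>n\<close>, its own index \<open>k\<close>, \<open>R\<close>, its neighbours (the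
  positions of the negative entries of its row), and the nodes it can exchange data with.\<close>

record local_view =
  size_of :: nat
  self :: nat
  hops :: nat
  nbrs :: "nat set"
  reach :: "nat set"

text \<open>An algorithm is one program run by all nodes. It prescribes the instructions of a node in
  a given round from the local view and from the outcomes of the comparisons this node has made
  so far. In particular, real data (matrix entries, right-hand side, \<open>\<epsilon>\<close>) can influence
  the computation only through instructions that have been executed.\<close>

type_synonym algorithm = "local_view \<Rightarrow> nat \<Rightarrow> bool list \<Rightarrow> instr list"

definition only_R_hop :: "algorithm \<Rightarrow> bool" where
  "only_R_hop A \<longleftrightarrow>
     (\<forall>K t h d j s. Fetch d j s \<in> set (A K t h) \<longrightarrow> j \<in> reach K)"

type_synonym node_state = "(reg \<Rightarrow> real) \<times> bool list"

fun arith :: "arith_op \<Rightarrow> real \<Rightarrow> real \<Rightarrow> real" where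
  "arith Plus x y = x + y"
| "arith Minus x y = x - y"
| "arith Times x y = x * y"
| "arith Divide x y = x / y"

fun exec_instr :: "(nat \<Rightarrow> node_state) \<Rightarrow> instr \<Rightarrow> node_state \<Rightarrow> node_state" where
  "exec_instr S (Arith f d a b) (\<rho>, h) = (\<rho>(d := arith f (\<rho> a) (\<rho> b)), h)"
| "exec_instr S (Const d c) (\<rho>, h) = (\<rho>(d := of_int c), h)"
| "exec_instr S (Fetch d j s) (\<rho>, h) = (\<rho>(d := fst (S j) s), h)"
| "exec_instr S (Test a b) (\<rho>, h) = (\<rho>, h @ [\<rho> a \<le> \<rho> b])"

definition view :: "real mat \<Rightarrow> nat \<Rightarrow> nat \<Rightarrow> local_view" where
  "view M R k =
     \<lparr>size_of = dim_row M, self = k, hops = R, nbrs = neighbours M k, reach = hop_nbhd M R k\<rparr>"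

fun input_reg :: "real mat \<Rightarrow> real vec \<Rightarrow> real \<Rightarrow> nat \<Rightarrow> reg \<Rightarrow> real" where
  "input_reg M b \<epsilon> k (Row j) = (if j < dim_col M then M $$ (k, j) else 0)"
| "input_reg M b \<epsilon> k Rhs = b $ k"
| "input_reg M b \<epsilon> k Eps = \<epsilon>"
| "input_reg M b \<epsilon> k Out = 0"
| "input_reg M b \<epsilon> k (Work i) = 0"

fun run :: "algorithm \<Rightarrow> real mat \<Rightarrow> real vec \<Rightarrow> nat \<Rightarrow> real \<Rightarrow> nat \<Rightarrow> nat \<Rightarrow> node_state" where
  "run A M b R \<epsilon> 0 = (\<lambda>k. (input_reg M b \<epsilon> k, []))"
| "run A M b R \<epsilon> (Suc t) =
     (let S = run A M b R \<epsilon> t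
      in (\<lambda>k. fold (exec_instr S) (A (view M R k) t (snd (S k))) (S k)))"

text \<open>A program does not halt by itself: all nodes stop after the same number \<open>N\<close> of rounds, which
  is not among the inputs of the program.\<close>

definition node_outputs :: "algorithm \<Rightarrow> real mat \<Rightarrow> real vec \<Rightarrow> nat \<Rightarrow> real \<Rightarrow> nat \<Rightarrow> real vec" where
  "node_outputs A M b R \<epsilon> N = vec (dim_row M) (\<lambda>k. fst (run A M b R \<epsilon> N k) Out)"

text \<open>Each instruction (also each comparison and each transfer of a number) takes one time step.
  As the nodes work in parallel and are synchronised, a round lasts as long as its slowest node.\<close>

definition time_steps :: "algorithm \<Rightarrow> real mat \<Rightarrow> real vec \<Rightarrow> nat \<Rightarrow> real \<Rightarrow> nat \<Rightarrow> nat" where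
  "time_steps A M b R \<epsilon> N =
     (\<Sum>t<N. Max ((\<lambda>k. length (A (view M R k) t (snd (run A M b R \<epsilon> t k)))) ` {..<dim_row M}))"

section \<open>The time bound\<close>

text \<open>For \<open>d = 1\<close> the quotient in the definition of \<open>\<alpha>\<close> is read as the geometric sum it stands
  for; division by zero would make it 0.\<close>

definition nbhd_bound :: "nat \<Rightarrow> nat \<Rightarrow> nat \<Rightarrow> real" where
  "nbhd_bound n d R =
     min (real n) (if d = 1 then real R + 1 else (real d ^ (R + 1) - 1) / (real d - 1))"

definition time_bound :: "real mat \<Rightarrow> nat \<Rightarrow> real \<Rightarrow> real" where
  "time_bound M R \<epsilon> =
     (let d = max_degree M; \<alpha> = nbhd_bound (dim_row M) d R
      in (\<alpha> * cond_num M / real R + \<alpha> * real R * real d) * ln (1 / \<epsilon>))"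

text \<open>As soon as the graph has an edge, the bound is at least 1. Without edges it tends to 0 for
  growing \<open>R\<close>, although at least one time step is needed.\<close>

lemma nbhd_bound_geometric: "nbhd_bound n d R = min (real n) (\<Sum>i\<le>R. real d ^ i)"
proof (cases "d = 1")
  case False
  then have "real d - 1 \<noteq> 0" by simp
  moreover have "real d ^ Suc R - 1 = (real d - 1) * (\<Sum>i<Suc R. real d ^ i)"
    by (rule power_diff_1_eq)
  ultimately show ?thesis
    using False by (simp add: nbhd_bound_def lessThan_Suc_atMost)
qed (simp add: nbhd_bound_def)

lemma time_bound_ge_1:
  assumes d: "max_degree M \<ge> 1" and n: "dim_row M \<ge> 1" and R: "R \<ge> 1"
    and eps: "0 < \<epsilon>" "\<epsilon> \<le> 1 / 2"
  shows "time_bound M R \<epsilon> \<ge> 1"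
proof -
  define a where "a = nbhd_bound (dim_row M) (max_degree M) R"
  have fin: "finite ((\<lambda>i. card (neighbours M i)) ` {..<dim_row M})" by simp
  have "(\<lambda>i. card (neighbours M i)) ` {..<dim_row M} \<noteq> {}" using n by (auto simp: lessThan_empty_iff)
  from Max_in[OF fin this] obtain i where i: "i < dim_row M" "card (neighbours M i) \<ge> 1"
    using d by (auto simp: max_degree_def)
  then obtain j where "j \<in> neighbours M i"
    by (metis card.empty ex_in_conv not_one_le_zero)
  then have n2: "dim_row M \<ge> 2" using i by (auto simp: neighbours_def edges_def)
  have "(\<Sum>i\<in>{0,1}. real (max_degree M) ^ i) \<le> (\<Sum>i\<le>R. real (max_degree M) ^ i)"
    using R by (intro sum_mono2) auto
  then have a2: "a \<ge> 2"
    using n2 d by (simp add: a_def nbhd_bound_geometric)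
  have "a * 1 * 1 \<le> a * real R * real (max_degree M)"
    using a2 R d by (intro mult_mono) auto
  moreover have "a * cond_num M / real R \<ge> 0"
    using a2 by (simp add: cond_num_def)
  ultimately have s: "a * cond_num M / real R + a * real R * real (max_degree M) \<ge> 2"
    using a2 by linarith
  have "ln 2 \<le> ln (1 / \<epsilon>)" using eps by (simp add: field_simps)
  then have l: "ln (1 / \<epsilon>) \<ge> 1 / 2" using ln_le_minus_one[of "1 / 2 :: real"] by (simp add: ln_div)
  have "2 * (1 / 2) \<le> (a * cond_num M / real R + a * real R * real (max_degree M)) * ln (1 / \<epsilon>)"
    using s l by (intro mult_mono) auto
  then show ?thesis by (simp add: time_bound_def Let_def a_def)
qed

end

theory Submission
  imports Defs "HOL-Analysis.Function_Topology"
begin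

text \<open>The algorithm is the Jacobi iteration, with \<open>R\<close> steps taken in a single communication round. Split
  \<open>M = D - A\<close> into its diagonal and the non-negative matrix \<open>A\<close>, and let \<open>W = D\<^sup>-\<^sup>1 A\<close>. The error of the
  iteration \<open>x \<mapsto> D\<^sup>-\<^sup>1 b + W x\<close> is multiplied by \<open>W\<close> in each step, and in the energy norm \<open>W\<close> contracts
  by the factor \<open>exp (- 1 / \<kappa>)\<close>: the diagonal entries are at most the largest eigenvalue, so
  \<open>D \<le> \<kappa> M\<close> as quadratic forms (lemma \<open>sddm_diag_le_energy\<close>), which bounds the spectrum of \<open>W\<close> from above by
  \<open>1 - 1 / \<kappa>\<close>, and, \<open>A\<close> being non-negative, also in modulus (lemma \<open>contraction_of_energy\<close>).
  Hence \<open>\<kappa> ln (1 / \<epsilon>)\<close> steps suffice (lemma \<open>jacobi_error\<close>).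

  The time bound has room for about \<open>\<kappa> / R * ln (1 / \<epsilon>)\<close> rounds of \<open>O(\<alpha>)\<close> instructions, each of which
  has to perform \<open>R\<close> of these steps by one multiplication with \<open>W\<^sup>R\<close>. To prepare for this, in the first
  \<open>R\<close> rounds every node computes its row of \<open>W\<^sup>R\<close> and the \<open>R\<close>-th Jacobi iterate from zero. As
  row \<open>k\<close> of \<open>W\<^sup>t\<^sup>+\<^sup>1\<close> is a combination of the rows of \<open>W\<^sup>t\<close> at the neighbours of \<open>k\<close>, and all these
  rows live on \<open>R\<close>-hop neighbourhoods, this costs \<open>O(\<alpha> d)\<close> per round (lemma \<open>run_power_phase\<close>).
  Afterwards a single round with \<open>O(\<alpha>)\<close> instructions applies the affine map \<open>R\<close> times
  (lemma \<open>run_leap_phase\<close>), and \<open>\<kappa> / R * ln (1 / \<epsilon>)\<close> such rounds, rounded up, give the accuracy \<open>\<epsilon>\<close>.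
  The two phases account for the two summands of the time bound.\<close>

section \<open>Quadratic forms and contraction in the energy norm\<close>

definition bil :: "nat \<Rightarrow> (nat \<Rightarrow> nat \<Rightarrow> real) \<Rightarrow> (nat \<Rightarrow> real) \<Rightarrow> (nat \<Rightarrow> real) \<Rightarrow> real" where
  "bil n m f g = (\<Sum>i<n. \<Sum>j<n. f i * m i j * g j)"

lemma bil_add_left: "bil n m (\<lambda>i. f i + g i) h = bil n m f h + bil n m g h"
  and bil_add_right: "bil n m h (\<lambda>i. f i + g i) = bil n m h f + bil n m h g"
  and bil_scale_left: "bil n m (\<lambda>i. c * f i) h = c * bil n m f h"
  and bil_scale_right: "bil n m h (\<lambda>i. c * f i) = c * bil n m h f"
  by (simp_all add: bil_def algebra_simps sum.distrib sum_distrib_left)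

lemma bil_commute:
  assumes "\<And>i j. i < n \<Longrightarrow> j < n \<Longrightarrow> m i j = m j i"
  shows "bil n m f g = bil n m g f"
proof -
  have "bil n m f g = (\<Sum>j<n. \<Sum>i<n. f i * m i j * g j)"
    unfolding bil_def by (rule sum.swap)
  also have "\<dots> = bil n m g f"
    unfolding bil_def using assms by (intro sum.cong refl) (simp add: mult_ac)
  finally show ?thesis .
qed

lemma bil_eq_sum_apply: "bil n m f g = (\<Sum>i<n. f i * (\<Sum>j<n. m i j * g j))"
  by (simp add: bil_def sum_distrib_left mult.assoc)

lemma sum_kronecker:
  fixes f :: "nat \<Rightarrow> real"
  assumes "i < n"
  shows "(\<Sum>j<n. (if j = i then 1 else 0) * f j) = f i"
    and "(\<Sum>j<n. f j * (if j = i then 1 else 0)) = f i"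
proof -
  have "(\<Sum>j<n. (if j = i then 1 else 0) * f j) = (\<Sum>j<n. if j = i then f j else 0)"
    by (intro sum.cong) auto
  then show "(\<Sum>j<n. (if j = i then 1 else 0) * f j) = f i" using assms by simp
  then show "(\<Sum>j<n. f j * (if j = i then 1 else 0)) = f i" by (simp only: mult.commute)
qed

lemma linear_coeff_zero:
  fixes a c :: real
  assumes "\<And>t. 0 \<le> 2 * t * a + t\<^sup>2 * c"
  shows "a = 0"
proof (rule ccontr)
  assume a: "a \<noteq> 0"
  define s where "s = \<bar>c\<bar> + 1"
  have s: "s > 0" "c < s" by (auto simp: s_def)
  have "0 \<le> 2 * (- a / s) * a + (- a / s)\<^sup>2 * c" using assms .
  also have "\<dots> = (a\<^sup>2 / s) * (c / s - 2)"
    using s by (simp add: field_simps power2_eq_square)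
  also have "\<dots> < 0"
    using a s by (intro mult_pos_neg) (auto simp: field_simps)
  finally show False by simp
qed

text \<open>The quadratic form attains its minimum \<open>\<mu>\<close> on the compact unit sphere, and there its first
  variation vanishes, which says that the minimiser is an eigenvector with eigenvalue \<open>\<mu>\<close>. This is
  the only part of the spectral theorem needed to compare a quadratic form with the extreme
  eigenvalues.\<close>

lemma rayleigh_minimum:
  fixes m :: "nat \<Rightarrow> nat \<Rightarrow> real"
  assumes n: "n \<ge> 1" and sym: "\<And>i j. i < n \<Longrightarrow> j < n \<Longrightarrow> m i j = m j i"
  shows "\<exists>\<mu> u. (\<exists>i<n. u i \<noteq> 0) \<and> (\<forall>i<n. (\<Sum>j<n. m i j * u j) = \<mu> * u i) \<and>
    (\<forall>v. \<mu> * (\<Sum>i<n. (v i)\<^sup>2) \<le> bil n m v v)"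
proof -
  \<comment> \<open>The sphere lives in the product topology on all sequences; zero coordinates beyond
    \<open>n\<close> make the surrounding box compact by Tychonoff's theorem.\<close>
  define B where "B = PiE UNIV (\<lambda>i. if i < n then {-1..1::real} else {0})"
  define S where "S = B \<inter> {v. (\<Sum>i<n. (v i)\<^sup>2) = 1}"
  have coord: "continuous_on UNIV (\<lambda>v::nat \<Rightarrow> real. v i)" for i
    by (rule continuous_on_product_coordinates)
  have "compactin (product_topology (\<lambda>i. euclidean) UNIV) B"
    unfolding B_def by (subst compactin_PiE) (auto simp: compactin_euclidean_iff)
  then have "compact B"
    by (simp add: euclidean_product_topology compactin_euclidean_iff)
  moreover have "closed {v::nat \<Rightarrow> real. (\<Sum>i<n. (v i)\<^sup>2) = 1}"
    by (intro closed_Collect_eq continuous_intros coord)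
  ultimately have "compact S" unfolding S_def by (rule compact_Int_closed)
  moreover have "(\<lambda>i. if i = 0 then 1 else 0) \<in> S"
    using n by (auto simp: S_def B_def if_distrib[of "\<lambda>x. x\<^sup>2"] cong: if_cong)
  moreover have "continuous_on S (\<lambda>v. bil n m v v)"
    unfolding bil_def by (intro continuous_intros continuous_on_subset[OF coord]) auto
  ultimately obtain u where u: "u \<in> S" and umin: "\<And>v. v \<in> S \<Longrightarrow> bil n m u u \<le> bil n m v v"
    using continuous_attains_inf[of S "\<lambda>v. bil n m v v"] by blast
  define \<mu> where "\<mu> = bil n m u u"
  have u1: "(\<Sum>i<n. (u i)\<^sup>2) = 1" using u by (simp add: S_def)
  have lower: "\<mu> * (\<Sum>i<n. (v i)\<^sup>2) \<le> bil n m v v" for v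
  proof (cases "(\<Sum>i<n. (v i)\<^sup>2) = 0")
    case True
    then have "\<forall>i<n. v i = 0" by (simp add: sum_nonneg_eq_0_iff)
    then show ?thesis by (simp add: bil_def)
  next
    case False
    define s where "s = (\<Sum>i<n. (v i)\<^sup>2)"
    have s: "s > 0" using False sum_nonneg[of "{..<n}" "\<lambda>i. (v i)\<^sup>2"] by (simp add: s_def)
    define w where "w = (\<lambda>i. if i < n then v i / sqrt s else 0)"
    have "\<bar>v i\<bar> \<le> sqrt s" if "i < n" for i
      unfolding s_def using that
      by (intro real_le_rsqrt) (simp, intro member_le_sum, auto)
    then have "- sqrt s \<le> v i" "v i \<le> sqrt s" if "i < n" for i
      using that by (fastforce simp: abs_le_iff)+
    then have "w i \<in> {-1..1}" if "i < n" for i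
      using s that by (auto simp: w_def field_simps)
    then have "w \<in> B" by (auto simp: B_def w_def)
    moreover have "(\<Sum>i<n. (w i)\<^sup>2) = 1"
      using s by (simp add: w_def power_divide flip: sum_divide_distrib) (simp add: s_def)
    ultimately have "\<mu> \<le> bil n m w w" unfolding \<mu>_def by (intro umin) (simp add: S_def)
    also have "bil n m w w = bil n m v v / s"
      using s by (simp add: bil_def w_def sum_divide_distrib mult_ac)
    finally show ?thesis using s by (simp add: field_simps s_def)
  qed
  have "(\<Sum>j<n. m i j * u j) = \<mu> * u i" if i: "i < n" for i
  proof -
    define e where "e = (\<lambda>j. if j = i then 1 else 0 :: real)"
    have bue: "bil n m e u = (\<Sum>j<n. m i j * u j)"
      using i by (simp add: bil_eq_sum_apply e_def sum_kronecker)
    have bee: "bil n m e e = m i i"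
      using i by (simp add: bil_eq_sum_apply e_def sum_kronecker)
    \<comment> \<open>The first variation of the form in the direction of the unit vector \<open>e\<close>.\<close>
    have "0 \<le> 2 * t * (bil n m e u - \<mu> * u i) + t\<^sup>2 * (m i i - \<mu>)" for t
    proof -
      have "(\<Sum>k<n. (u k + t * e k)\<^sup>2) = (\<Sum>k<n. (u k)\<^sup>2) + 2 * t * u i + t\<^sup>2"
        using i by (simp add: power2_sum sum.distrib e_def if_distrib[of "\<lambda>x. x\<^sup>2"] if_distrib[of "\<lambda>x. _ * x"] mult_ac cong: if_cong)
      moreover have ue: "bil n m u e = bil n m e u" by (rule bil_commute[OF sym])
      moreover have "bil n m (\<lambda>k. u k + t * e k) (\<lambda>k. u k + t * e k)
          = \<mu> + 2 * t * bil n m e u + t\<^sup>2 * m i i"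
        by (simp add: bil_add_left bil_add_right bil_scale_left bil_scale_right bee \<mu>_def
            ue algebra_simps power2_eq_square)
      ultimately show ?thesis
        using lower[of "\<lambda>k. u k + t * e k"] u1 by (simp add: algebra_simps)
    qed
    from linear_coeff_zero[OF this] show ?thesis by (simp add: bue)
  qed
  moreover have "\<exists>i<n. u i \<noteq> 0"
    using u1 by (metis (no_types, lifting) lessThan_iff sum.neutral zero_neq_one zero_power2)
  ultimately show ?thesis using lower by blast
qed

text \<open>Write \<open>D\<close> for the diagonal of the matrix, \<open>A = D - M \<ge> 0\<close> and \<open>W = D\<^sup>-\<^sup>1 A\<close>, which is
  self-adjoint in the inner product of \<open>D\<close>; in this inner product \<open>M\<close> is \<open>1 - W\<close>. The lower bound on
  \<open>M\<close> says \<open>W \<le> \<rho>\<close>. As \<open>A\<close> has non-negative entries, replacing \<open>v\<close> by its entrywise modulus yields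
  \<open>- \<rho> \<le> W\<close> too, so both \<open>\<rho> - W\<close> and \<open>\<rho> + W\<close> are positive semidefinite. The claim
  \<open>(\<rho>\<^sup>2 - W\<^sup>2) (1 - W) \<ge> 0\<close> then follows without diagonalising from the identities
  \<open>2 \<rho> (\<rho>\<^sup>2 - W\<^sup>2) = (\<rho> + W) (\<rho> - W) (\<rho> + W) + (\<rho> - W) (\<rho> + W) (\<rho> - W)\<close> and
  \<open>(\<rho>\<^sup>2 - W\<^sup>2) (1 - W) = (1 - \<rho>) (\<rho>\<^sup>2 - W\<^sup>2) + (\<rho> - W) (\<rho> + W) (\<rho> - W)\<close>, in which all triple
  products are congruences of semidefinite operators.\<close>

lemma contraction_of_energy:
  fixes m :: "nat \<Rightarrow> nat \<Rightarrow> real"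
  assumes sym: "\<And>i j. i < n \<Longrightarrow> j < n \<Longrightarrow> m i j = m j i"
    and offdiag: "\<And>i j. i < n \<Longrightarrow> j < n \<Longrightarrow> i \<noteq> j \<Longrightarrow> m i j \<le> 0"
    and diag: "\<And>i. i < n \<Longrightarrow> m i i > 0"
    and \<rho>: "0 < \<rho>" "\<rho> < 1"
    and lower: "\<And>v. (1 - \<rho>) * (\<Sum>i<n. m i i * (v i)\<^sup>2) \<le> bil n m v v"
  defines "W \<equiv> \<lambda>v i. \<Sum>j<n. (if j = i then 0 else - m i j / m i i) * v j"
  shows "bil n m (W v) (W v) \<le> \<rho>\<^sup>2 * bil n m v v"
proof -
  define D where "D = bil n (\<lambda>i j. if i = j then m i i else 0)"
  define A where "A = bil n (\<lambda>i j. if i = j then 0 else - m i j)"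
  note bils = bil_add_left bil_add_right bil_scale_left bil_scale_right
  have D: "D f g = (\<Sum>i<n. f i * m i i * g i)" for f g
  proof -
    have "D f g = (\<Sum>i<n. \<Sum>j<n. if i = j then f i * m i i * g i else 0)"
      unfolding D_def bil_def by (intro sum.cong refl) auto
    then show ?thesis by simp
  qed
  have Acomm: "A f g = A g f" for f g
    unfolding A_def by (rule bil_commute) (use sym in auto)
  have Dcomm: "D f g = D g f" for f g unfolding D by (simp add: mult_ac)
  have M: "bil n m f g = D f g - A f g" for f g
    unfolding D_def A_def bil_def sum_subtractf[symmetric]
    by (intro sum.cong refl) (auto simp: algebra_simps)
  have DW: "D f (W g) = A f g" for f g
  proof -
    have "m i i * W g i = (\<Sum>j<n. (if i = j then 0 else - m i j) * g j)" if "i < n" for i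
      unfolding W_def sum_distrib_left using diag[OF that] by (intro sum.cong refl) auto
    then show ?thesis
      unfolding D A_def bil_eq_sum_apply by (intro sum.cong refl) (simp add: mult.assoc)
  qed
  have WD: "D (W f) g = A f g" for f g using DW Dcomm Acomm by metis
  have DA: "D v v = (\<Sum>i<n. m i i * (v i)\<^sup>2)" for v
    unfolding D by (intro sum.cong) (auto simp: power2_eq_square)
  have upper: "A v v \<le> \<rho> * D v v" for v
    using lower[of v] unfolding M DA[symmetric] by (simp add: algebra_simps)
  have absA: "\<bar>A v v\<bar> \<le> \<rho> * D v v" for v
  proof -
    have "\<bar>A v v\<bar> \<le> A (\<lambda>i. \<bar>v i\<bar>) (\<lambda>i. \<bar>v i\<bar>)"
      unfolding A_def bil_def
      by (intro order_trans[OF sum_abs] sum_mono) (use offdiag in \<open>auto simp: abs_mult\<close>)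
    also have "\<dots> \<le> \<rho> * D (\<lambda>i. \<bar>v i\<bar>) (\<lambda>i. \<bar>v i\<bar>)" by (rule upper)
    also have "\<dots> = \<rho> * D v v" by (simp add: DA)
    finally show ?thesis .
  qed
  have plus: "0 \<le> \<rho> * D v v + A v v" and minus: "0 \<le> \<rho> * D v v - A v v" for v
    using absA[of v] by linarith+
  \<comment> \<open>The vectors \<open>p = (\<rho> + W) v\<close> and \<open>q = (\<rho> - W) v\<close> of the two congruences.\<close>
  define p where "p = (\<lambda>i. \<rho> * v i + W v i)"
  define q where "q = (\<lambda>i. \<rho> * v i + (-1) * W v i)"
  define x y z where "x = D v v" and "y = A v v" and "z = D (W v) (W v)"
  define t where "t = A (W v) (W v)"
  have z': "A v (W v) = z" "A (W v) v = z"
    unfolding z_def using WD[of v "W v"] Acomm by auto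
  have Dp: "D p p = \<rho>\<^sup>2 * x + 2 * \<rho> * y + z" 
    unfolding p_def D_def bils using DW WD
    by (simp add: D_def[symmetric] x_def y_def z_def algebra_simps power2_eq_square)
  have Dq: "D q q = \<rho>\<^sup>2 * x - 2 * \<rho> * y + z"
    unfolding q_def D_def bils using DW WD
    by (simp add: D_def[symmetric] x_def y_def z_def algebra_simps power2_eq_square)
  have Ap: "A p p = \<rho>\<^sup>2 * y + 2 * \<rho> * z + t"
    unfolding p_def A_def bils using z'
    by (simp add: A_def[symmetric] x_def y_def t_def algebra_simps power2_eq_square)
  have Aq: "A q q = \<rho>\<^sup>2 * y - 2 * \<rho> * z + t"
    unfolding q_def A_def bils using z'
    by (simp add: A_def[symmetric] x_def y_def t_def algebra_simps power2_eq_square)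
  have q: "0 \<le> \<rho> * (\<rho>\<^sup>2 * x - 2 * \<rho> * y + z) + (\<rho>\<^sup>2 * y - 2 * \<rho> * z + t)"
    using plus[of q] by (simp add: Dq Aq)
  have p: "0 \<le> \<rho> * (\<rho>\<^sup>2 * x + 2 * \<rho> * y + z) - (\<rho>\<^sup>2 * y + 2 * \<rho> * z + t)"
    using minus[of p] by (simp add: Dp Ap)
  have "0 \<le> (2 * \<rho>) * (\<rho>\<^sup>2 * x - z)"
    using p q by (simp add: algebra_simps)
  then have "0 \<le> \<rho>\<^sup>2 * x - z" using \<rho> by (simp add: zero_le_mult_iff)
  then have "0 \<le> (1 - \<rho>) * (\<rho>\<^sup>2 * x - z)" using \<rho> by simp
  moreover have "(1 - \<rho>) * (\<rho>\<^sup>2 * x - z) + (\<rho> * (\<rho>\<^sup>2 * x - 2 * \<rho> * y + z) + (\<rho>\<^sup>2 * y - 2 * \<rho> * z + t))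
     = \<rho>\<^sup>2 * (x - y) - (z - t)"
    by (simp add: algebra_simps power2_eq_square)
  ultimately have "z - t \<le> \<rho>\<^sup>2 * (x - y)" using q by linarith
  then show ?thesis by (simp add: M x_def y_def z_def t_def)
qed

section \<open>Jacobi iteration for SDDM matrices\<close>

lemma bil_cong:
  assumes "\<And>i. i < n \<Longrightarrow> f i = f' i" "\<And>i. i < n \<Longrightarrow> g i = g' i"
  shows "bil n m f g = bil n m f' g'"
  unfolding bil_def using assms by (intro sum.cong refl) simp

lemma quadratic_form_eq_bil:
  assumes "M \<in> carrier_mat n n" "u \<in> carrier_vec n"
  shows "u \<bullet> (M *\<^sub>v u) = bil n (\<lambda>i j. M $$ (i, j)) (($) u) (($) u)"
  using assms
  by (auto simp: bil_eq_sum_apply scalar_prod_def atLeast0LessThan intro!: sum.cong)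

lemma spectrumI:
  assumes M: "M \<in> carrier_mat n n" and nz: "\<exists>i<n. u i \<noteq> 0"
    and eq: "\<And>i. i < n \<Longrightarrow> (\<Sum>j<n. M $$ (i, j) * u j) = \<mu> * u i"
  shows "\<mu> \<in> spectrum (M :: real mat)"
proof -
  have "vec n u \<noteq> 0\<^sub>v n" using nz by (metis index_vec index_zero_vec(1))
  moreover have "M *\<^sub>v vec n u = \<mu> \<cdot>\<^sub>v vec n u"
  proof (rule eq_vecI)
    fix i assume "i < dim_vec (\<mu> \<cdot>\<^sub>v vec n u)"
    then have i: "i < n" by simp
    then have "(M *\<^sub>v vec n u) $ i = (\<Sum>j<n. M $$ (i, j) * u j)"
      using M by (auto simp: scalar_prod_def atLeast0LessThan intro!: sum.cong)
    then show "(M *\<^sub>v vec n u) $ i = (\<mu> \<cdot>\<^sub>v vec n u) $ i" using eq i by simp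
  qed (use M in simp)
  ultimately show ?thesis
    using M unfolding spectrum_def eigenvalue_def eigenvector_def
    by (auto intro!: exI[of _ "vec n u"])
qed

lemma sddm_diag_pos:
  assumes "sddm n M" "k < n"
  shows "M $$ (k, k) > 0"
proof -
  have M: "M \<in> carrier_mat n n" and pd: "pos_def n M" using assms by (auto simp: sddm_def)
  have "unit_vec n k \<bullet> (M *\<^sub>v unit_vec n k) > 0"
    using pd assms(2) unfolding pos_def_def
    by (metis unit_vec_carrier unit_vec_nonzero)
  then show ?thesis using M assms(2) by simp
qed

lemma sddm_sym:
  assumes "sddm n M" "i < n" "j < n"
  shows "M $$ (i, j) = M $$ (j, i)"
  using assms unfolding sddm_def by (metis carrier_matD index_transpose_mat(1))

text \<open>This is where the condition number enters: a diagonal entry is a Rayleigh quotient, hence at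
  most the largest eigenvalue, while the energy dominates the smallest eigenvalue times the squared
  Euclidean norm.\<close>

lemma sddm_diag_le_energy:
  assumes sd: "sddm n M" and n: "n \<ge> 1"
  shows "cond_num M > 0"
    "(\<Sum>i<n. M $$ (i, i) * (v i)\<^sup>2) \<le> cond_num M * bil n (\<lambda>i j. M $$ (i, j)) v v"
proof -
  let ?m = "\<lambda>i j. M $$ (i, j)"
  have M: "M \<in> carrier_mat n n" and pd: "pos_def n M" using sd by (auto simp: sddm_def)
  have fin: "finite (spectrum M)" using card_finite_spectrum[OF M] by simp
  have "\<exists>\<mu> u. (\<exists>i<n. u i \<noteq> 0) \<and> (\<forall>i<n. (\<Sum>j<n. ?m i j * u j) = \<mu> * u i) \<and>
      (\<forall>v. \<mu> * (\<Sum>i<n. (v i)\<^sup>2) \<le> bil n ?m v v)"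
    by (rule rayleigh_minimum[OF n]) (rule sddm_sym[OF sd])
  then obtain \<mu> u where mu: "\<exists>i<n. u i \<noteq> 0" "\<forall>i<n. (\<Sum>j<n. ?m i j * u j) = \<mu> * u i"
    "\<forall>v. \<mu> * (\<Sum>i<n. (v i)\<^sup>2) \<le> bil n ?m v v"
    by (elim exE, elim conjE) (rule that)
  have "\<exists>\<mu> u. (\<exists>i<n. u i \<noteq> 0) \<and> (\<forall>i<n. (\<Sum>j<n. - ?m i j * u j) = \<mu> * u i) \<and>
      (\<forall>v. \<mu> * (\<Sum>i<n. (v i)\<^sup>2) \<le> bil n (\<lambda>i j. - ?m i j) v v)"
    by (rule rayleigh_minimum[OF n]) (simp add: sddm_sym[OF sd])
  then obtain \<nu> w where nu: "\<exists>i<n. w i \<noteq> 0" "\<forall>i<n. (\<Sum>j<n. - ?m i j * w j) = \<nu> * w i"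
    "\<forall>v. \<nu> * (\<Sum>i<n. (v i)\<^sup>2) \<le> bil n (\<lambda>i j. - ?m i j) v v"
    by (elim exE, elim conjE) (rule that)
  have mu_in: "\<mu> \<in> spectrum M" using mu(2) by (intro spectrumI[OF M mu(1)]) simp
  have nu_in: "- \<nu> \<in> spectrum M"
    using nu(2) by (intro spectrumI[OF M nu(1)]) (simp add: sum_negf minus_equation_iff)
  define l L where "l = Min (spectrum M)" and "L = Max (spectrum M)"
  have "l \<in> spectrum M" unfolding l_def using fin mu_in by (intro Min_in) auto
  then obtain x where x: "x \<in> carrier_vec n" "x \<noteq> 0\<^sub>v n" "M *\<^sub>v x = l \<cdot>\<^sub>v x"
    using M by (auto simp: spectrum_def eigenvalue_def eigenvector_def)
  then have "0 < l * (x \<bullet> x)" using pd unfolding pos_def_def by (metis scalar_prod_smult_right carrier_vecD)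
  moreover have "x \<bullet> x \<ge> 0" by (auto simp: scalar_prod_def intro!: sum_nonneg)
  ultimately have l: "l > 0" by (simp add: zero_less_mult_iff)
  have l_mu: "l \<le> \<mu>" unfolding l_def using fin mu_in by simp
  have L_nu: "- \<nu> \<le> L" unfolding L_def using fin nu_in by simp
  have lL: "l \<le> L" unfolding l_def L_def using fin mu_in by (meson Max_ge Min_le order_trans)
  have diag: "M $$ (i, i) \<le> L" if i: "i < n" for i
    using nu(3)[THEN spec, of "\<lambda>j. if j = i then 1 else 0"] i L_nu
    by (simp add: bil_eq_sum_apply sum_negf if_distrib[of "\<lambda>x. x\<^sup>2"] sum_kronecker cong: if_cong)
  have cn: "cond_num M = L / l" using l lL by (simp add: cond_num_def l_def L_def)
  show "cond_num M > 0" using cn l lL by simp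
  have "(\<Sum>i<n. M $$ (i, i) * (v i)\<^sup>2) \<le> L * (\<Sum>i<n. (v i)\<^sup>2)"
    unfolding sum_distrib_left by (intro sum_mono mult_right_mono diag) auto
  also have "\<dots> = L / l * (l * (\<Sum>i<n. (v i)\<^sup>2))" using l by simp
  also have "\<dots> \<le> L / l * (\<mu> * (\<Sum>i<n. (v i)\<^sup>2))"
    using l lL l_mu by (intro mult_left_mono mult_right_mono sum_nonneg) auto
  also have "\<dots> \<le> L / l * bil n ?m v v"
    using l lL by (intro mult_left_mono mu(3)[THEN spec]) auto
  finally show "(\<Sum>i<n. M $$ (i, i) * (v i)\<^sup>2) \<le> cond_num M * bil n ?m v v" by (simp add: cn)
qed

lemma sddm_solvable:
  assumes sd: "sddm n M" and b: "b \<in> carrier_vec n"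
  obtains x where "x \<in> carrier_vec n" "M *\<^sub>v x = b"
proof -
  have M: "M \<in> carrier_mat n n" and pd: "pos_def n M" using sd by (auto simp: sddm_def)
  have "det M \<noteq> 0"
  proof
    assume "det M = 0"
    then obtain v where v: "v \<in> carrier_vec n" "v \<noteq> 0\<^sub>v n" "M *\<^sub>v v = 0\<^sub>v n"
      using det_0_iff_vec_prod_zero_field[OF M] by auto
    then have "0 < v \<bullet> 0\<^sub>v n" using pd unfolding pos_def_def by metis
    then show False using v by simp
  qed
  from det_non_zero_imp_unit[OF M this, of "()"]
  obtain B where "B \<in> carrier_mat n n" "M * B = 1\<^sub>m n"
    by (auto simp: Units_def ring_mat_def)
  then have "M *\<^sub>v (B *\<^sub>v b) = b" "B *\<^sub>v b \<in> carrier_vec n"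
    using M b assoc_mult_mat_vec[of M n n B n b] by auto
  then show ?thesis using that by blast
qed

text \<open>The Jacobi method solves \<open>M x = b\<close> row by row for the diagonal unknown. Its iteration matrix
  \<open>W = D\<^sup>-\<^sup>1 A\<close> has a non-zero entry only along an edge of the graph.\<close>

definition jacobi_mat :: "real mat \<Rightarrow> nat \<Rightarrow> nat \<Rightarrow> real" where
  "jacobi_mat M k j = (if j = k then 0 else - M $$ (k, j) / M $$ (k, k))"

definition jacobi_step :: "real mat \<Rightarrow> real vec \<Rightarrow> (nat \<Rightarrow> real) \<Rightarrow> nat \<Rightarrow> real" where
  "jacobi_step M b v k = b $ k / M $$ (k, k) + (\<Sum>j<dim_row M. jacobi_mat M k j * v j)"

fun jacobi_pow :: "real mat \<Rightarrow> nat \<Rightarrow> nat \<Rightarrow> nat \<Rightarrow> real" where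
  "jacobi_pow M 0 k j = (if k = j then 1 else 0)"
| "jacobi_pow M (Suc t) k j = (\<Sum>i<dim_row M. jacobi_mat M k i * jacobi_pow M t i j)"

abbreviation jacobi_iter :: "real mat \<Rightarrow> real vec \<Rightarrow> nat \<Rightarrow> nat \<Rightarrow> real" where
  "jacobi_iter M b t \<equiv> (jacobi_step M b ^^ t) (\<lambda>_. 0)"

lemma jacobi_step_funpow_Suc:
  "(jacobi_step M b ^^ Suc t) v k
    = b $ k / M $$ (k, k) + (\<Sum>j<dim_row M. jacobi_mat M k j * (jacobi_step M b ^^ t) v j)"
  by (simp add: jacobi_step_def[of M b "(jacobi_step M b ^^ t) v"])

text \<open>The \<open>t\<close>-th iterate of an affine map is affine, with the \<open>t\<close>-th power of the linear part. So one
  application of \<open>W\<^sup>R\<close> performs \<open>R\<close> Jacobi steps at once.\<close>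

lemma funpow_jacobi_step:
  assumes "k < dim_row M"
  shows "(jacobi_step M b ^^ t) v k = jacobi_iter M b t k + (\<Sum>j<dim_row M. jacobi_pow M t k j * v j)"
  using assms
proof (induction t arbitrary: k)
  case 0
  have "(\<Sum>j<dim_row M. jacobi_pow M 0 k j * v j) = (\<Sum>j<dim_row M. if k = j then v j else 0)"
    by (intro sum.cong) auto
  then show ?case using 0 by simp
next
  case (Suc t)
  let ?n = "dim_row M"
  have "(\<Sum>i<?n. jacobi_mat M k i * (\<Sum>j<?n. jacobi_pow M t i j * v j))
      = (\<Sum>j<?n. jacobi_pow M (Suc t) k j * v j)"
    by (simp add: sum_distrib_left sum_distrib_right mult.assoc)
      (rule sum.swap)
  moreover have "(\<Sum>i<?n. jacobi_mat M k i * (jacobi_step M b ^^ t) v i)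
     = (\<Sum>i<?n. jacobi_mat M k i * jacobi_iter M b t i) +
       (\<Sum>i<?n. jacobi_mat M k i * (\<Sum>j<?n. jacobi_pow M t i j * v j))"
    unfolding sum.distrib[symmetric] using Suc.IH by (intro sum.cong) (auto simp: distrib_left)
  ultimately show ?case
    by (simp only: jacobi_step_funpow_Suc)
qed

text \<open>The factor \<open>\<rho> = exp (- 1 / \<kappa>)\<close> is chosen because it exceeds \<open>1 - 1 / \<kappa>\<close>, is positive even for
  \<open>\<kappa> = 1\<close>, and has the powers in which the number of rounds is expressed most easily.\<close>

lemma jacobi_error:
  assumes sd: "sddm n M" and n: "n \<ge> 1"
    and x: "x \<in> carrier_vec n" "M *\<^sub>v x = b"
  shows "energy_norm M (x - vec n (jacobi_iter M b t))
    \<le> exp (- real t / cond_num M) * energy_norm M x"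
proof -
  let ?m = "\<lambda>i j. M $$ (i, j)"
  define \<rho> where "\<rho> = exp (- (1 / cond_num M))"
  note M = conjunct1[OF sd[unfolded sddm_def]]
  note kpos = sddm_diag_le_energy(1)[OF sd n]
  have rho: "0 < \<rho>" "\<rho> < 1" using kpos by (simp_all add: \<rho>_def)
  have sub: "1 - \<rho> \<le> 1 / cond_num M"
    using exp_ge_add_one_self[of "- (1 / cond_num M)"] by (simp add: \<rho>_def)
  have lower: "(1 - \<rho>) * (\<Sum>i<n. ?m i i * (v i)\<^sup>2) \<le> bil n ?m v v" for v
  proof -
    have "(1 - \<rho>) * (\<Sum>i<n. ?m i i * (v i)\<^sup>2) \<le> 1 / cond_num M * (\<Sum>i<n. ?m i i * (v i)\<^sup>2)"
      using sub sddm_diag_pos[OF sd]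
      by (intro mult_right_mono sum_nonneg mult_nonneg_nonneg) (auto simp: less_imp_le)
    also have "\<dots> \<le> 1 / cond_num M * (cond_num M * bil n ?m v v)"
      using kpos by (intro mult_left_mono sddm_diag_le_energy(2)[OF sd n]) auto
    finally show ?thesis using kpos by simp
  qed
  define e where "e = (\<lambda>t i. x $ i - jacobi_iter M b t i)"
  have e_Suc: "e (Suc t) i = (\<Sum>j<n. (if j = i then 0 else - ?m i j / ?m i i) * e t j)"
    if i: "i < n" for t i
  proof -
    have mi: "?m i i > 0" using sddm_diag_pos[OF sd i] .
    have "b $ i = (\<Sum>j<n. ?m i j * x $ j)"
      using x i M by (auto simp: scalar_prod_def atLeast0LessThan)
    also have "\<dots> = ?m i i * x $ i - ?m i i * (\<Sum>j<n. jacobi_mat M i j * x $ j)"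
    proof -
      have "(\<Sum>j<n. ?m i j * x $ j) =
        (\<Sum>j<n. (if j = i then ?m i i * x $ i else 0) - ?m i i * (jacobi_mat M i j * x $ j))"
        using mi by (intro sum.cong) (auto simp: jacobi_mat_def)
      then show ?thesis using i by (simp add: sum_subtractf sum_distrib_left)
    qed
    finally have "x $ i = b $ i / ?m i i + (\<Sum>j<n. jacobi_mat M i j * x $ j)"
      using mi by (simp add: field_simps)
    then have "e (Suc t) i = (\<Sum>j<n. jacobi_mat M i j * e t j)"
      using M by (simp add: e_def jacobi_step_funpow_Suc right_diff_distrib sum_subtractf del: funpow.simps)
    then show ?thesis by (simp add: jacobi_mat_def)
  qed
  have main: "bil n ?m (e t) (e t) \<le> (\<rho> ^ t)\<^sup>2 * bil n ?m (($) x) (($) x)"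
  proof (induction t)
    case 0
    show ?case by (simp add: e_def)
  next
    case (Suc t)
    have "bil n ?m (e (Suc t)) (e (Suc t)) \<le> \<rho>\<^sup>2 * bil n ?m (e t) (e t)"
      using contraction_of_energy[of n ?m \<rho> "e t", OF sddm_sym[OF sd] _ sddm_diag_pos[OF sd] rho lower]
        sd e_Suc bil_cong[of n "e (Suc t)" _ "e (Suc t)" _ ?m, OF e_Suc e_Suc]
      by (simp add: sddm_def)
    also have "\<dots> \<le> \<rho>\<^sup>2 * ((\<rho> ^ t)\<^sup>2 * bil n ?m (($) x) (($) x))"
      by (intro mult_left_mono Suc) auto
    finally show ?case by (simp add: power_mult_distrib mult.assoc)
  qed
  have "energy_norm M (x - vec n (jacobi_iter M b t)) = sqrt (bil n ?m (e t) (e t))"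
    unfolding energy_norm_def
    using quadratic_form_eq_bil[OF M, of "x - vec n (jacobi_iter M b t)"] x
    by (simp add: e_def cong: bil_cong)
  also have "\<dots> \<le> sqrt ((\<rho> ^ t)\<^sup>2 * bil n ?m (($) x) (($) x))"
    using main by simp
  also have "\<dots> = \<rho> ^ t * energy_norm M x"
    using rho quadratic_form_eq_bil[OF M x(1)]
    by (simp add: real_sqrt_mult energy_norm_def)
  also have "\<rho> ^ t = exp (- real t / cond_num M)"
    by (simp add: \<rho>_def flip: exp_of_nat_mult)
  finally show ?thesis .
qed

section \<open>Powers of the iteration matrix and neighbourhoods\<close>

lemma jacobi_mat_eq_0:
  assumes "sddm n M" "k < n" "i < n" "i \<notin> neighbours M k"
  shows "jacobi_mat M k i = 0"
  using assms by (force simp: sddm_def neighbours_def edges_def weight_def jacobi_mat_def)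

text \<open>Powers of \<open>W\<close> up to the \<open>R\<close>-th are supported on the \<open>R\<close>-hop neighbourhoods: a node needs to
  store and to combine only that many entries of its row.\<close>

lemma jacobi_pow_path:
  assumes sd: "sddm n M"
  shows "k < n \<Longrightarrow> jacobi_pow M t k j \<noteq> 0 \<Longrightarrow> (k, j) \<in> edges M ^^ t"
proof (induction t arbitrary: k)
  case 0
  then show ?case by (simp split: if_splits)
next
  case (Suc t)
  have dim: "dim_row M = n" using sd by (auto simp: sddm_def)
  from Suc.prems obtain i where i: "i < n" "jacobi_mat M k i * jacobi_pow M t i j \<noteq> 0"
    using dim by (auto elim!: sum.not_neutral_contains_not_neutral)
  then have "(k, i) \<in> edges M"
    using jacobi_mat_eq_0[OF sd, of k i] Suc.prems by (auto simp: neighbours_def)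
  then show ?case using Suc.IH[of i] i by (intro relpow_Suc_I2) auto
qed

text \<open>The infimum of extended naturals is attained unless it is infinite.\<close>

lemma hop_nbhd_iff:
  "j \<in> hop_nbhd M R k \<longleftrightarrow> j < dim_row M \<and> (\<exists>t\<le>R. (k, j) \<in> edges M ^^ t)"
proof -
  have "hop_dist M k j \<le> enat R \<longleftrightarrow> (\<exists>t\<le>R. (k, j) \<in> edges M ^^ t)"
  proof
    assume le: "hop_dist M k j \<le> enat R"
    define X where "X = enat ` {t. (k, j) \<in> edges M ^^ t}"
    have "X \<noteq> {}"
    proof
      assume "X = {}"
      then have "hop_dist M k j = \<infinity>" by (simp add: hop_dist_def X_def top_enat_def)
      then show False using le by simp
    qed
    then have "Inf X \<in> X" by (auto simp: Inf_enat_def intro: LeastI)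
    then show "\<exists>t\<le>R. (k, j) \<in> edges M ^^ t"
      using le by (auto simp: hop_dist_def X_def)
  next
    assume "\<exists>t\<le>R. (k, j) \<in> edges M ^^ t"
    then obtain t where t: "t \<le> R" "(k, j) \<in> edges M ^^ t" by blast
    then have "hop_dist M k j \<le> enat t" unfolding hop_dist_def by (intro INF_lower) auto
    then show "hop_dist M k j \<le> enat R" using t by (meson enat_ord_simps(1) order_trans)
  qed
  then show ?thesis by (simp add: hop_nbhd_def)
qed

lemma finite_neighbours: "finite (neighbours M k)"
  by (rule finite_subset[of _ "{..<dim_row M}"]) (auto simp: neighbours_def edges_def)

lemma finite_hop_nbhd: "finite (hop_nbhd M R k)"
  by (rule finite_subset[of _ "{..<dim_row M}"]) (auto simp: hop_nbhd_def)

lemma neighbours_subset_hop_nbhd: "R \<ge> 1 \<Longrightarrow> neighbours M k \<subseteq> hop_nbhd M R k"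
  by (auto simp: hop_nbhd_iff neighbours_def edges_def intro!: exI[of _ "1::nat"])

lemma card_neighbours_le: "card (neighbours M k) \<le> max_degree M"
proof (cases "k < dim_row M")
  case True
  then show ?thesis unfolding max_degree_def by (intro Max_ge) auto
next
  case False
  then have "neighbours M k = {}" by (auto simp: neighbours_def edges_def)
  then show ?thesis by simp
qed

text \<open>There are at most \<open>d\<^sup>t\<close> end points of walks of length \<open>t\<close>.\<close>

lemma card_hop_nbhd_le: "real (card (hop_nbhd M R k)) \<le> nbhd_bound (dim_row M) (max_degree M) R"
proof -
  define sph where "sph t = {j. (k, j) \<in> edges M ^^ t}" for t
  have sph: "finite (sph t) \<and> card (sph t) \<le> max_degree M ^ t" for t
  proof (induction t)
    case 0
    show ?case by (simp add: sph_def)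
  next
    case (Suc t)
    have eq: "sph (Suc t) = (\<Union>i\<in>sph t. neighbours M i)"
      by (auto simp: sph_def neighbours_def)
    have "card (sph (Suc t)) \<le> (\<Sum>i\<in>sph t. card (neighbours M i))"
      unfolding eq using Suc by (intro card_UN_le) simp
    also have "\<dots> \<le> card (sph t) * max_degree M"
      using sum_bounded_above[of "sph t" "\<lambda>i. card (neighbours M i)" "max_degree M"]
        card_neighbours_le by simp
    also have "\<dots> \<le> max_degree M ^ t * max_degree M" using Suc by simp
    finally show ?case using Suc finite_neighbours by (simp add: eq mult.commute)
  qed
  have "card (hop_nbhd M R k) \<le> card (\<Union>t\<le>R. sph t)"
    using sph by (intro card_mono) (auto simp: hop_nbhd_iff sph_def)
  also have "\<dots> \<le> (\<Sum>t\<le>R. card (sph t))" by (intro card_UN_le) simp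
  also have "\<dots> \<le> (\<Sum>t\<le>R. max_degree M ^ t)" using sph by (intro sum_mono) simp
  finally have "real (card (hop_nbhd M R k)) \<le> (\<Sum>t\<le>R. real (max_degree M) ^ t)"
    by (metis (mono_tags, lifting) of_nat_le_iff of_nat_power of_nat_sum sum.cong)
  moreover have "card (hop_nbhd M R k) \<le> card {..<dim_row M}"
    by (intro card_mono) (auto simp: hop_nbhd_def)
  ultimately show ?thesis by (simp add: nbhd_bound_geometric)
qed

section \<open>The distributed program\<close>

text \<open>Register use: \<open>coef j\<close> holds the entry in column \<open>j\<close> of the node's row of the current power of
  \<open>W\<close>; \<open>acc\<close> holds the current Jacobi iterate of the first phase; \<open>Row i\<close> and \<open>Rhs\<close> are
  overwritten by the entry of \<open>W\<close> and by \<open>b k / M k k\<close>. All other \<open>coef\<close> registers keep their initial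
  value 0, so that fetching an entry outside the support also gives the right value.\<close>

abbreviation "tmp \<equiv> Work 0"
abbreviation "acc \<equiv> Work 1"
abbreviation "coef j \<equiv> Work (j + 2)"

definition gather :: "reg \<Rightarrow> (nat \<times> reg \<times> reg) list \<Rightarrow> instr list" where
  "gather d xs = concat (map (\<lambda>(i, s, c).
     [Fetch tmp i s, Arith Times tmp tmp c, Arith Plus d d tmp]) xs)"

text \<open>The intersection with \<open>reach\<close> matters only for local views other than those of a matrix with
  \<open>R \<ge> 1\<close>: there, too, the program must not fetch from afar.\<close>

definition nbr_list :: "local_view \<Rightarrow> nat list" where
  "nbr_list K = sorted_list_of_set (nbrs K \<inter> reach K)"

definition reach_list :: "local_view \<Rightarrow> nat list" where
  "reach_list K = sorted_list_of_set (reach K)"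

definition init_code :: "local_view \<Rightarrow> instr list" where
  "init_code K =
     [Const tmp 0, Arith Minus tmp tmp (Row (self K)),
      Arith Divide Rhs Rhs (Row (self K)), Arith Plus acc acc Rhs] @
     concat (map (\<lambda>i. [Arith Divide (Row i) (Row i) tmp, Arith Plus (coef i) (coef i) (Row i)])
       (nbr_list K))"

definition column_code :: "nat list \<Rightarrow> nat \<Rightarrow> instr list" where
  "column_code ns j = Const (coef j) 0 # gather (coef j) (map (\<lambda>i. (i, coef j, Row i)) ns)"

text \<open>One Jacobi step, and one multiplication of the power by \<open>W\<close>, from the values of the neighbours.
  Registers can be overwritten in place, as a fetch sees the beginning of the round and a node is not
  its own neighbour. An isolated node has reached its fixed point already and stays idle, because the
  time bound of a graph without edges does not allow \<open>R\<close> rounds of work.\<close>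

definition power_code :: "local_view \<Rightarrow> instr list" where
  "power_code K = (if nbr_list K = [] then [] else
     [Const acc 0, Arith Plus acc acc Rhs] @
     gather acc (map (\<lambda>i. (i, acc, Row i)) (nbr_list K)) @
     concat (map (column_code (nbr_list K)) (reach_list K)))"

text \<open>\<open>R\<close> Jacobi steps at once: the new output is \<open>acc\<close>, the \<open>R\<close>-th iterate from zero, plus the row of
  \<open>W\<^sup>R\<close> applied to the old outputs.\<close>

definition leap_code :: "local_view \<Rightarrow> instr list" where
  "leap_code K = [Const Out 0, Arith Plus Out Out acc] @
     gather Out (map (\<lambda>j. (j, Out, coef j)) (reach_list K))"

definition jacobi_algorithm :: algorithm where
  "jacobi_algorithm K t h =
     (if t = 0 then init_code K else if t < hops K then power_code K else leap_code K)"

section \<open>Execution of the program\<close>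

lemma length_gather: "length (gather d xs) = 3 * length xs"
  by (induction xs) (auto simp: gather_def)

lemma Fetch_in_gather: "Fetch d j s \<in> set (gather r xs) \<Longrightarrow> j \<in> fst ` set xs"
  by (force simp: gather_def)

lemma set_nbr_list: "set (nbr_list K) \<subseteq> reach K"
  unfolding nbr_list_def by (cases "finite (nbrs K \<inter> reach K)") auto

lemma set_reach_list: "set (reach_list K) \<subseteq> reach K"
  unfolding reach_list_def by (cases "finite (reach K)") auto

lemma only_R_hop_jacobi_algorithm: "only_R_hop jacobi_algorithm"
  unfolding only_R_hop_def
proof (intro allI impI)
  fix K t h d j s
  assume "Fetch d j s \<in> set (jacobi_algorithm K t h)"
  then have "j \<in> set (nbr_list K) \<union> set (reach_list K)"
    by (auto simp: jacobi_algorithm_def init_code_def power_code_def leap_code_def column_code_def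
        dest!: Fetch_in_gather split: if_splits)
  then show "j \<in> reach K" using set_nbr_list set_reach_list by auto
qed

lemma exec_gather:
  assumes "d \<noteq> tmp" "\<forall>(i, s, c)\<in>set xs. c \<noteq> tmp \<and> c \<noteq> d"
  shows "\<exists>v. fold (exec_instr S) (gather d xs) (\<rho>, h)
    = (\<rho>(d := \<rho> d + (\<Sum>(i, s, c)\<leftarrow>xs. fst (S i) s * \<rho> c), tmp := v), h)"
  using assms
proof (induction xs arbitrary: \<rho>)
  case Nil
  then show ?case by (auto simp: gather_def intro!: exI[of _ "\<rho> tmp"])
next
  case (Cons x xs)
  obtain i s c where x: "x = (i, s, c)" by (cases x)
  have c: "c \<noteq> tmp" "c \<noteq> d" using Cons.prems x by auto
  define \<rho>' where "\<rho>' = \<rho>(tmp := fst (S i) s * \<rho> c, d := \<rho> d + fst (S i) s * \<rho> c)"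
  have step: "fold (exec_instr S) (gather d (x # xs)) (\<rho>, h) = fold (exec_instr S) (gather d xs) (\<rho>', h)"
    using c Cons.prems(1) by (simp add: gather_def x \<rho>'_def)
  have prem: "\<forall>(i, s, c)\<in>set xs. c \<noteq> tmp \<and> c \<noteq> d" using Cons.prems(2) by simp
  obtain v where v: "fold (exec_instr S) (gather d xs) (\<rho>', h)
    = (\<rho>'(d := \<rho>' d + (\<Sum>(i, s, c)\<leftarrow>xs. fst (S i) s * \<rho>' c), tmp := v), h)"
    using Cons.IH[of \<rho>', OF Cons.prems(1) prem] by blast
  have "(\<Sum>(i, s, c)\<leftarrow>xs. fst (S i) s * \<rho>' c) = (\<Sum>(i, s, c)\<leftarrow>xs. fst (S i) s * \<rho> c)"
    using Cons.prems by (intro arg_cong[where f = sum_list] map_cong refl) (auto simp: \<rho>'_def)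
  then show ?case
    unfolding step v using Cons.prems(1)
    by (auto simp: \<rho>'_def x fun_eq_iff intro!: exI[of _ v])
qed

lemma exec_gather_map:
  assumes "d \<noteq> tmp" "distinct ns" "\<And>i. i \<in> set ns \<Longrightarrow> c i \<noteq> tmp \<and> c i \<noteq> d"
  shows "\<exists>v. fold (exec_instr S) (gather d (map (\<lambda>i. (i, s, c i)) ns)) (\<rho>, h)
    = (\<rho>(d := \<rho> d + (\<Sum>i\<in>set ns. \<rho> (c i) * fst (S i) s), tmp := v), h)"
proof -
  have "(\<Sum>(i, s, c)\<leftarrow>map (\<lambda>i. (i, s, c i)) ns. fst (S i) s * \<rho> c)
    = (\<Sum>i\<in>set ns. \<rho> (c i) * fst (S i) s)"
    using assms(2) by (simp add: o_def sum_list_distinct_conv_sum_set mult.commute)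
  moreover have "\<forall>(i, s', c')\<in>set (map (\<lambda>i. (i, s, c i)) ns). c' \<noteq> tmp \<and> c' \<noteq> d"
    using assms(3) by auto
  ultimately show ?thesis
    using exec_gather[OF assms(1), of "map (\<lambda>i. (i, s, c i)) ns" S \<rho> h] by simp
qed

lemma exec_init_code:
  assumes "self K \<notin> set (nbr_list K)" and zero: "\<And>i. \<rho> (Work i) = 0"
  shows "\<exists>\<rho>'. fold (exec_instr S) (init_code K) (\<rho>, h) = (\<rho>', h) \<and>
    \<rho>' Rhs = \<rho> Rhs / \<rho> (Row (self K)) \<and> \<rho>' acc = \<rho>' Rhs \<and> \<rho>' Out = \<rho> Out \<and>
    (\<forall>i\<in>set (nbr_list K). \<rho>' (Row i) = - \<rho> (Row i) / \<rho> (Row (self K)) \<and> \<rho>' (coef i) = \<rho>' (Row i)) \<and>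
    (\<forall>i. i \<notin> set (nbr_list K) \<longrightarrow> \<rho>' (coef i) = 0)"
proof -
  define \<rho>1 where "\<rho>1 = \<rho>(tmp := - \<rho> (Row (self K)), Rhs := \<rho> Rhs / \<rho> (Row (self K)),
     acc := \<rho> Rhs / \<rho> (Row (self K)))"
  have loop: "distinct ns \<Longrightarrow> \<exists>\<rho>'. fold (exec_instr S) (concat (map (\<lambda>i.
      [Arith Divide (Row i) (Row i) tmp, Arith Plus (coef i) (coef i) (Row i)]) ns)) (\<sigma>, h) = (\<rho>', h) \<and>
      (\<forall>i\<in>set ns. \<rho>' (Row i) = \<sigma> (Row i) / \<sigma> tmp \<and> \<rho>' (coef i) = \<sigma> (coef i) + \<rho>' (Row i)) \<and>
      (\<forall>r. r \<notin> Row ` set ns \<longrightarrow> r \<notin> coef ` set ns \<longrightarrow> \<rho>' r = \<sigma> r)" for ns \<sigma>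
  proof (induction ns arbitrary: \<sigma>)
    case Nil
    show ?case by simp
  next
    case (Cons i ns)
    define \<sigma>' where "\<sigma>' = \<sigma>(Row i := \<sigma> (Row i) / \<sigma> tmp, coef i := \<sigma> (coef i) + \<sigma> (Row i) / \<sigma> tmp)"
    have i: "i \<notin> set ns" "distinct ns" using Cons.prems by auto
    obtain \<rho>' where r: "fold (exec_instr S) (concat (map (\<lambda>i.
      [Arith Divide (Row i) (Row i) tmp, Arith Plus (coef i) (coef i) (Row i)]) ns)) (\<sigma>', h) = (\<rho>', h)"
      "\<forall>i\<in>set ns. \<rho>' (Row i) = \<sigma>' (Row i) / \<sigma>' tmp \<and> \<rho>' (coef i) = \<sigma>' (coef i) + \<rho>' (Row i)"
      "\<forall>r. r \<notin> Row ` set ns \<longrightarrow> r \<notin> coef ` set ns \<longrightarrow> \<rho>' r = \<sigma>' r"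
      using Cons.IH[OF i(2), of \<sigma>'] by blast
    have "\<rho>' (Row i) = \<sigma>' (Row i)" "\<rho>' (coef i) = \<sigma>' (coef i)" using r(3)[rule_format, of "Row i"] r(3)[rule_format, of "coef i"] i by auto
    then show ?case
      using r i by (intro exI[of _ \<rho>']) (auto simp: \<sigma>'_def)
  qed
  have "distinct (nbr_list K)" by (simp add: nbr_list_def)
  from loop[OF this, of \<rho>1]
  obtain \<rho>' where r: "fold (exec_instr S) (concat (map (\<lambda>i.
     [Arith Divide (Row i) (Row i) tmp, Arith Plus (coef i) (coef i) (Row i)]) (nbr_list K))) (\<rho>1, h) = (\<rho>', h)"
     "\<forall>i\<in>set (nbr_list K). \<rho>' (Row i) = \<rho>1 (Row i) / \<rho>1 tmp \<and> \<rho>' (coef i) = \<rho>1 (coef i) + \<rho>' (Row i)"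
     "\<forall>r. r \<notin> Row ` set (nbr_list K) \<longrightarrow> r \<notin> coef ` set (nbr_list K) \<longrightarrow> \<rho>' r = \<rho>1 r"
    by blast
  have "fold (exec_instr S) (init_code K) (\<rho>, h) = (\<rho>', h)"
    using r(1) by (simp add: init_code_def \<rho>1_def zero fun_upd_twist)
  moreover have "\<rho>' Rhs = \<rho>1 Rhs" "\<rho>' acc = \<rho>1 acc" "\<rho>' Out = \<rho>1 Out"
    using r(3) by auto
  moreover have "\<rho>' (coef i) = \<rho>1 (coef i)" if "i \<notin> set (nbr_list K)" for i
    using r(3)[rule_format, of "coef i"] that by auto
  ultimately show ?thesis
    using r(2) by (intro exI[of _ \<rho>']) (simp add: \<rho>1_def zero)
qed

lemma exec_columns:
  assumes "distinct ns" "distinct js"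
  shows "\<exists>\<rho>'. fold (exec_instr S) (concat (map (column_code ns) js)) (\<rho>, h) = (\<rho>', h) \<and>
    (\<forall>j\<in>set js. \<rho>' (coef j) = (\<Sum>i\<in>set ns. \<rho> (Row i) * fst (S i) (coef j))) \<and>
    (\<forall>r. r \<noteq> tmp \<longrightarrow> r \<notin> coef ` set js \<longrightarrow> \<rho>' r = \<rho> r)"
  using assms(2)
proof (induction js arbitrary: \<rho>)
  case Nil
  then show ?case by auto
next
  case (Cons j js)
  obtain v where v: "fold (exec_instr S) (column_code ns j) (\<rho>, h) =
      (\<rho>(coef j := \<Sum>i\<in>set ns. \<rho> (Row i) * fst (S i) (coef j), tmp := v), h)"
    using exec_gather_map[of "coef j" ns Row S "coef j" "\<rho>(coef j := 0)" h] assms(1)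
    by (auto simp: column_code_def)
  define \<rho>1 where "\<rho>1 = \<rho>(coef j := \<Sum>i\<in>set ns. \<rho> (Row i) * fst (S i) (coef j), tmp := v)"
  obtain \<rho>' where r: "fold (exec_instr S) (concat (map (column_code ns) js)) (\<rho>1, h) = (\<rho>', h)"
    "\<forall>j\<in>set js. \<rho>' (coef j) = (\<Sum>i\<in>set ns. \<rho>1 (Row i) * fst (S i) (coef j))"
    "\<forall>r. r \<noteq> tmp \<longrightarrow> r \<notin> coef ` set js \<longrightarrow> \<rho>' r = \<rho>1 r"
    using Cons.IH[of \<rho>1] Cons.prems by auto
  have "fold (exec_instr S) (concat (map (column_code ns) (j # js))) (\<rho>, h) = (\<rho>', h)"
    using v r(1) by (simp add: \<rho>1_def)
  then show ?case
    using r(2,3) Cons.prems by (intro exI[of _ \<rho>']) (auto simp: \<rho>1_def)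
qed

lemma exec_power_code:
  assumes "nbr_list K \<noteq> []"
  shows "\<exists>\<rho>'. fold (exec_instr S) (power_code K) (\<rho>, h) = (\<rho>', h) \<and>
    \<rho>' acc = \<rho> Rhs + (\<Sum>i\<in>set (nbr_list K). \<rho> (Row i) * fst (S i) acc) \<and>
    (\<forall>j\<in>set (reach_list K). \<rho>' (coef j) = (\<Sum>i\<in>set (nbr_list K). \<rho> (Row i) * fst (S i) (coef j))) \<and>
    (\<forall>j. j \<notin> set (reach_list K) \<longrightarrow> \<rho>' (coef j) = \<rho> (coef j)) \<and>
    \<rho>' Rhs = \<rho> Rhs \<and> \<rho>' Out = \<rho> Out \<and> (\<forall>i. \<rho>' (Row i) = \<rho> (Row i))"
proof -
  let ?ns = "nbr_list K"
  have dist: "distinct ?ns" "distinct (reach_list K)" by (simp_all add: nbr_list_def reach_list_def)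
  obtain v where v: "fold (exec_instr S) (gather acc (map (\<lambda>i. (i, acc, Row i)) ?ns)) (\<rho>(acc := \<rho> Rhs), h)
    = (\<rho>(acc := \<rho> Rhs + (\<Sum>i\<in>set ?ns. \<rho> (Row i) * fst (S i) acc), tmp := v), h)"
    using exec_gather_map[of acc ?ns Row S acc "\<rho>(acc := \<rho> Rhs)" h] dist by auto
  obtain \<rho>' where "fold (exec_instr S) (concat (map (column_code ?ns) (reach_list K)))
      (\<rho>(acc := \<rho> Rhs + (\<Sum>i\<in>set ?ns. \<rho> (Row i) * fst (S i) acc), tmp := v), h) = (\<rho>', h)"
    and r: "\<forall>j\<in>set (reach_list K). \<rho>' (coef j) = (\<Sum>i\<in>set ?ns. \<rho> (Row i) * fst (S i) (coef j))"
    "\<forall>r. r \<noteq> tmp \<longrightarrow> r \<notin> coef ` set (reach_list K) \<longrightarrow>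
      \<rho>' r = (\<rho>(acc := \<rho> Rhs + (\<Sum>i\<in>set ?ns. \<rho> (Row i) * fst (S i) acc), tmp := v)) r"
    using exec_columns[OF dist, of S "\<rho>(acc := \<rho> Rhs + (\<Sum>i\<in>set ?ns. \<rho> (Row i) * fst (S i) acc), tmp := v)" h]
    by auto
  then have "fold (exec_instr S) (power_code K) (\<rho>, h) = (\<rho>', h)"
    using assms v by (simp add: power_code_def)
  then show ?thesis using r by (intro exI[of _ \<rho>']) auto
qed

lemma exec_leap_code:
  "\<exists>v. fold (exec_instr S) (leap_code K) (\<rho>, h) =
    (\<rho>(Out := \<rho> acc + (\<Sum>j\<in>set (reach_list K). \<rho> (coef j) * fst (S j) Out), tmp := v), h)"
proof -
  have "distinct (reach_list K)" by (simp add: reach_list_def)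
  then show ?thesis
    using exec_gather_map[of Out "reach_list K" coef S Out "\<rho>(Out := \<rho> acc)" h]
    by (auto simp: leap_code_def)
qed

lemma nbr_list_view:
  assumes "R \<ge> 1"
  shows "set (nbr_list (view M R k)) = neighbours M k" "length (nbr_list (view M R k)) = card (neighbours M k)"
proof -
  have "nbr_list (view M R k) = sorted_list_of_set (neighbours M k)"
    using neighbours_subset_hop_nbhd[OF assms, of M k] by (simp add: nbr_list_def view_def Int_absorb2)
  then show "set (nbr_list (view M R k)) = neighbours M k" "length (nbr_list (view M R k)) = card (neighbours M k)"
    by (simp_all add: finite_neighbours)
qed

lemma reach_list_view:
  "set (reach_list (view M R k)) = hop_nbhd M R k" "length (reach_list (view M R k)) = card (hop_nbhd M R k)"
  by (simp_all add: reach_list_def view_def finite_hop_nbhd)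

text \<open>The invariant starts after one round, since \<open>W\<^sup>0\<close> is never stored.\<close>

lemma run_power_phase:
  assumes sd: "sddm n M" and R: "R \<ge> 1"
    and t: "1 \<le> t" "t \<le> R" and k: "k < n"
  shows "\<exists>\<rho>. run jacobi_algorithm M b R \<epsilon> t k = (\<rho>, []) \<and>
    \<rho> Rhs = b $ k / M $$ (k, k) \<and> (\<forall>i\<in>neighbours M k. \<rho> (Row i) = jacobi_mat M k i) \<and>
    (\<forall>j<n. \<rho> (coef j) = jacobi_pow M t k j) \<and> \<rho> acc = jacobi_iter M b t k \<and> \<rho> Out = 0"
  using t k
proof (induction t arbitrary: k rule: nat_induct_at_least)
  case base
  have dim: "dim_row M = n" "dim_col M = n" using sd by (auto simp: sddm_def)
  define K where "K = view M R k"
  have K: "self K = k" by (simp add: K_def view_def)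
  have ns: "set (nbr_list K) = neighbours M k" unfolding K_def using nbr_list_view(1)[OF R] .
  have nk: "neighbours M k \<subseteq> {..<n}" "k \<notin> neighbours M k" using dim by (auto simp: neighbours_def edges_def)
  obtain \<rho>' where r: "fold (exec_instr (run jacobi_algorithm M b R \<epsilon> 0)) (init_code K) (input_reg M b \<epsilon> k, []) = (\<rho>', [])"
    "\<rho>' Rhs = b $ k / M $$ (k, k)" "\<rho>' acc = \<rho>' Rhs" "\<rho>' Out = 0"
    "\<forall>i\<in>neighbours M k. \<rho>' (Row i) = - M $$ (k, i) / M $$ (k, k) \<and> \<rho>' (coef i) = \<rho>' (Row i)"
    "\<forall>i. i \<notin> neighbours M k \<longrightarrow> \<rho>' (coef i) = 0"
    using exec_init_code[of K "input_reg M b \<epsilon> k" "run jacobi_algorithm M b R \<epsilon> 0" "[]"]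
      base nk by (auto simp: ns K dim subset_iff)
  have row: "\<forall>i\<in>neighbours M k. \<rho>' (Row i) = jacobi_mat M k i"
    using r(5) nk by (auto simp: jacobi_mat_def)
  have pow1: "jacobi_pow M 1 k j = jacobi_mat M k j" if "j < n" for j
  proof -
    have "jacobi_pow M 1 k j = (\<Sum>i<n. jacobi_mat M k i * (if i = j then 1 else 0))"
      by (simp add: dim)
    then show ?thesis using sum_kronecker(2)[OF that] by simp
  qed
  have "\<rho>' (coef j) = jacobi_pow M 1 k j" if "j < n" for j
    using pow1[OF that] row r(5,6) jacobi_mat_eq_0[OF sd base(2) that]
    by (cases "j \<in> neighbours M k") auto
  moreover have "jacobi_iter M b 1 k = b $ k / M $$ (k, k)" by (simp add: jacobi_step_def)
  ultimately show ?case
    using r row by (intro exI[of _ \<rho>']) (simp add: jacobi_algorithm_def K_def Let_def)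
next
  case (Suc t)
  have dim: "dim_row M = n" "dim_col M = n" using sd by (auto simp: sddm_def)
  define K where "K = view M R k"
  define S where "S = run jacobi_algorithm M b R \<epsilon> t"
  have ns: "set (nbr_list K) = neighbours M k" unfolding K_def using nbr_list_view(1)[OF R] .
  have rs: "set (reach_list K) = hop_nbhd M R k" unfolding K_def by (rule reach_list_view)
  have nk: "neighbours M k \<subseteq> {..<n}" using dim by (auto simp: neighbours_def edges_def)
  have IH: "\<exists>\<rho>. S k = (\<rho>, []) \<and>
    \<rho> Rhs = b $ k / M $$ (k, k) \<and> (\<forall>i\<in>neighbours M k. \<rho> (Row i) = jacobi_mat M k i) \<and>
    (\<forall>j<n. \<rho> (coef j) = jacobi_pow M t k j) \<and> \<rho> acc = jacobi_iter M b t k \<and> \<rho> Out = 0"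
    if "k < n" for k using Suc.IH[of k] Suc.prems that by (simp add: S_def)
  obtain \<rho> where \<rho>: "S k = (\<rho>, [])" "\<rho> Rhs = b $ k / M $$ (k, k)"
    "\<forall>i\<in>neighbours M k. \<rho> (Row i) = jacobi_mat M k i"
    "\<forall>j<n. \<rho> (coef j) = jacobi_pow M t k j" "\<rho> acc = jacobi_iter M b t k" "\<rho> Out = 0"
    using IH[OF Suc.prems(2)] by blast
  have Sacc: "fst (S i) acc = jacobi_iter M b t i" if "i < n" for i using IH[OF that] by auto
  have Scoef: "fst (S i) (coef j) = jacobi_pow M t i j" if "i < n" "j < n" for i j using IH[OF that(1)] that by auto
  have nsum: "(\<Sum>i\<in>neighbours M k. jacobi_mat M k i * f i) = (\<Sum>i<n. jacobi_mat M k i * f i)" for f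
    using nk jacobi_mat_eq_0[OF sd Suc.prems(2)] by (intro sum.mono_neutral_left) auto
  \<comment> \<open>The columns that are not recomputed hold 0 before and after the round.\<close>
  have far: "jacobi_pow M u k j = 0" if "j < n" "j \<notin> hop_nbhd M R k" "u \<le> R" for u j
    using that jacobi_pow_path[OF sd Suc.prems(2), of u j] by (auto simp: hop_nbhd_iff dim)
  have run: "run jacobi_algorithm M b R \<epsilon> (Suc t) k = fold (exec_instr S) (power_code K) (\<rho>, [])"
    using Suc.hyps Suc.prems \<rho>(1) by (simp add: S_def[symmetric] jacobi_algorithm_def K_def view_def)
  have it: "jacobi_iter M b (Suc t) k
      = b $ k / M $$ (k, k) + (\<Sum>i\<in>neighbours M k. jacobi_mat M k i * jacobi_iter M b t i)"
    by (simp only: jacobi_step_funpow_Suc nsum dim)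
  have pw: "jacobi_pow M (Suc t) k j = (\<Sum>i\<in>neighbours M k. jacobi_mat M k i * jacobi_pow M t i j)" for j
    by (simp add: nsum dim)
  show ?case
  proof (cases "nbr_list K = []")
    case True
    then have emp: "neighbours M k = {}" using ns by simp
    obtain t' where t': "t = Suc t'" using Suc.hyps by (cases t) auto
    have "jacobi_iter M b (Suc t) k = jacobi_iter M b t k"
      unfolding it emp unfolding t' jacobi_step_funpow_Suc dim nsum[symmetric] emp by simp
    moreover have "jacobi_pow M (Suc t) k j = jacobi_pow M t k j" for j
      unfolding pw emp unfolding t' jacobi_pow.simps dim nsum[symmetric] emp by simp
    ultimately show ?thesis
      using \<rho> unfolding run by (simp add: power_code_def True del: jacobi_pow.simps funpow.simps)
  next
    case False
    obtain \<rho>' where r: "fold (exec_instr S) (power_code K) (\<rho>, []) = (\<rho>', [])"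
      "\<rho>' acc = \<rho> Rhs + (\<Sum>i\<in>neighbours M k. \<rho> (Row i) * fst (S i) acc)"
      "\<forall>j\<in>hop_nbhd M R k. \<rho>' (coef j) = (\<Sum>i\<in>neighbours M k. \<rho> (Row i) * fst (S i) (coef j))"
      "\<forall>j. j \<notin> hop_nbhd M R k \<longrightarrow> \<rho>' (coef j) = \<rho> (coef j)"
      "\<rho>' Rhs = \<rho> Rhs" "\<rho>' Out = \<rho> Out" "\<forall>i. \<rho>' (Row i) = \<rho> (Row i)"
      using exec_power_code[OF False, of S \<rho> "[]"] unfolding ns rs by blast
    have "\<rho>' acc = jacobi_iter M b (Suc t) k"
      unfolding r(2) it \<rho>(2) using \<rho>(3) Sacc nk
      by (intro arg_cong2[where f = "(+)"] sum.cong refl) auto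
    moreover have "\<rho>' (coef j) = jacobi_pow M (Suc t) k j" if j: "j < n" for j
    proof (cases "j \<in> hop_nbhd M R k")
      case True
      then have "\<rho>' (coef j) = (\<Sum>i\<in>neighbours M k. \<rho> (Row i) * fst (S i) (coef j))" using r(3) by blast
      also have "\<dots> = jacobi_pow M (Suc t) k j"
        unfolding pw using \<rho>(3) Scoef[OF _ j] nk by (intro sum.cong refl) auto
      finally show ?thesis .
    next
      case False
      then show ?thesis using r(4) \<rho>(4) j far[OF j False] Suc.prems by (simp del: jacobi_pow.simps)
    qed
    ultimately show ?thesis
      using r \<rho> unfolding run by (simp del: jacobi_pow.simps funpow.simps)
  qed
qed

text \<open>Every round of the second phase advances the output by \<open>R\<close> Jacobi iterates. For \<open>m = 0\<close> the
  output is still the initial value 0, which is the iterate from which the leaps start.\<close>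

lemma run_leap_phase:
  assumes sd: "sddm n M" and R: "R \<ge> 1" and k: "k < n"
  shows "\<exists>\<rho>. run jacobi_algorithm M b R \<epsilon> (R + m) k = (\<rho>, []) \<and>
    (\<forall>j<n. \<rho> (coef j) = jacobi_pow M R k j) \<and> \<rho> acc = jacobi_iter M b R k \<and>
    \<rho> Out = jacobi_iter M b (R * m) k"
  using k
proof (induction m arbitrary: k)
  case 0
  then show ?case using run_power_phase[OF sd R R order_refl, of k b \<epsilon>] by auto
next
  case (Suc m)
  have dim: "dim_row M = n" using sd by (auto simp: sddm_def)
  define K where "K = view M R k"
  define S where "S = run jacobi_algorithm M b R \<epsilon> (R + m)"
  have rs: "set (reach_list K) = hop_nbhd M R k" unfolding K_def by (rule reach_list_view)
  have SOut: "fst (S i) Out = jacobi_iter M b (R * m) i" if "i < n" for i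
    using Suc.IH[OF that] by (auto simp: S_def)
  obtain \<rho> where \<rho>: "S k = (\<rho>, [])" "\<forall>j<n. \<rho> (coef j) = jacobi_pow M R k j"
    "\<rho> acc = jacobi_iter M b R k"
    using Suc.IH[OF Suc.prems] by (auto simp: S_def)
  obtain v where v: "fold (exec_instr S) (leap_code K) (\<rho>, []) =
    (\<rho>(Out := \<rho> acc + (\<Sum>j\<in>hop_nbhd M R k. \<rho> (coef j) * fst (S j) Out), tmp := v), [])"
    using exec_leap_code[of S K \<rho> "[]"] unfolding rs by blast
  have run: "run jacobi_algorithm M b R \<epsilon> (R + Suc m) k = fold (exec_instr S) (leap_code K) (\<rho>, [])"
    using R \<rho>(1) by (simp add: S_def[symmetric] jacobi_algorithm_def K_def view_def)
  have far: "jacobi_pow M R k j = 0" if "j < n" "j \<notin> hop_nbhd M R k" for j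
    using that jacobi_pow_path[OF sd Suc.prems, of R j] by (auto simp: hop_nbhd_iff dim)
  have "(\<Sum>j\<in>hop_nbhd M R k. \<rho> (coef j) * fst (S j) Out)
      = (\<Sum>j\<in>hop_nbhd M R k. jacobi_pow M R k j * jacobi_iter M b (R * m) j)"
    using \<rho>(2) SOut by (intro sum.cong) (auto simp: hop_nbhd_def dim)
  also have "\<dots> = (\<Sum>j<n. jacobi_pow M R k j * jacobi_iter M b (R * m) j)"
    using far by (intro sum.mono_neutral_left) (auto simp: hop_nbhd_def dim)
  finally have leap: "(\<Sum>j\<in>hop_nbhd M R k. \<rho> (coef j) * fst (S j) Out)
      = (\<Sum>j<n. jacobi_pow M R k j * jacobi_iter M b (R * m) j)" .
  have "\<rho> acc + (\<Sum>j\<in>hop_nbhd M R k. \<rho> (coef j) * fst (S j) Out)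
      = (jacobi_step M b ^^ R) (jacobi_iter M b (R * m)) k"
    unfolding leap \<rho>(3)
    using funpow_jacobi_step[of k M R b "jacobi_iter M b (R * m)"] Suc.prems by (simp add: dim)
  also have "\<dots> = jacobi_iter M b (R * Suc m) k"
    by (simp add: funpow_add)
  finally show ?case
    unfolding run v using \<rho>(2,3) by simp
qed

section \<open>Time steps\<close>

lemma length_init_code: "length (init_code K) = 4 + 2 * length (nbr_list K)"
  by (simp add: init_code_def length_concat o_def sum_list_triv)

lemma length_power_code:
  "length (power_code K) = (if nbr_list K = [] then 0 else
     2 + 3 * length (nbr_list K) + length (reach_list K) * (1 + 3 * length (nbr_list K)))"
  by (simp add: power_code_def length_gather length_concat o_def column_code_def sum_list_triv)

lemma length_leap_code: "length (leap_code K) = 2 + 3 * length (reach_list K)"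
  by (simp add: leap_code_def length_gather)

lemma nbhd_bound_ge_1:
  assumes "n \<ge> 1"
  shows "nbhd_bound n d R \<ge> 1"
proof -
  have "real d ^ 0 \<le> (\<Sum>i\<le>R. real d ^ i)" by (rule member_le_sum) auto
  then show ?thesis using assms by (simp add: nbhd_bound_geometric)
qed

text \<open>In a round of the first phase a node treats at most \<open>\<alpha>\<close> columns with at most \<open>d\<close> neighbours each,
  in a round of the second phase at most \<open>\<alpha>\<close> entries. For \<open>d = 0\<close> the middle bound is 0, which holds
  thanks to the idling of isolated nodes.\<close>

lemma round_length_le:
  fixes R t k :: nat and M :: "real mat" and h :: "bool list"
  assumes n: "dim_row M \<ge> 1" and R: "R \<ge> 1"
  defines "d \<equiv> real (max_degree M)" and "\<alpha> \<equiv> nbhd_bound (dim_row M) (max_degree M) R"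
  shows "real (length (jacobi_algorithm (view M R k) t h))
    \<le> (if t = 0 then 4 + 2 * d else if t < R then 9 * \<alpha> * d else 5 * \<alpha>)"
proof -
  let ?K = "view M R k"
  define a r where "a = real (length (nbr_list ?K))" and "r = real (length (reach_list ?K))"
  have \<alpha>: "1 \<le> \<alpha>" unfolding \<alpha>_def using n by (rule nbhd_bound_ge_1)
  have a: "a \<le> d" unfolding a_def d_def nbr_list_view(2)[OF R] using card_neighbours_le by simp
  have r: "0 \<le> r" "r \<le> \<alpha>" unfolding r_def \<alpha>_def reach_list_view(2) using card_hop_nbhd_le by simp_all
  consider "t = 0" | "0 < t" "t < R" "nbr_list ?K = []" | "0 < t" "t < R" "nbr_list ?K \<noteq> []" | "0 < t" "R \<le> t"
    by linarith
  then show ?thesis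
  proof cases
    case 1
    then show ?thesis using a by (simp add: jacobi_algorithm_def length_init_code a_def)
  next
    case 2
    then show ?thesis using \<alpha> by (simp add: jacobi_algorithm_def power_code_def view_def d_def)
  next
    case 3
    have a1: "1 \<le> a" using 3 by (simp add: a_def Suc_le_eq)
    then have d1: "1 \<le> d" using a by simp
    have "real (length (jacobi_algorithm ?K t h)) = 2 + 3 * a + r * (1 + 3 * a)"
      using 3 by (simp add: jacobi_algorithm_def length_power_code a_def r_def view_def algebra_simps)
    also have "\<dots> \<le> 2 + 3 * d + \<alpha> * (1 + 3 * d)"
      using a a1 r by (intro add_mono mult_mono) auto
    also have "\<dots> \<le> 9 * \<alpha> * d"
    proof -
      have "1 * d \<le> \<alpha> * d" "\<alpha> * 1 \<le> \<alpha> * d" using \<alpha> d1 by (intro mult_right_mono mult_left_mono; simp)+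
      moreover have "\<alpha> * (1 + 3 * d) = \<alpha> + 3 * (\<alpha> * d)" "9 * \<alpha> * d = 9 * (\<alpha> * d)"
        by (simp_all add: algebra_simps)
      ultimately show ?thesis using d1 by linarith
    qed
    finally show ?thesis using 3 by simp
  next
    case 4
    then show ?thesis using r \<alpha> by (simp add: jacobi_algorithm_def length_leap_code r_def view_def)
  qed
qed

lemma time_steps_le:
  fixes M :: "real mat"
  assumes n: "dim_row M \<ge> 1" and R: "R \<ge> 1"
  defines "d \<equiv> real (max_degree M)" and "\<alpha> \<equiv> nbhd_bound (dim_row M) (max_degree M) R"
  shows "real (time_steps jacobi_algorithm M b R \<epsilon> (R + m))
    \<le> 4 + 2 * d + real R * (9 * \<alpha> * d) + real m * (5 * \<alpha>)"
proof -
  let ?B = "\<lambda>t. if t = 0 then 4 + 2 * d else if t < R then 9 * \<alpha> * d else 5 * \<alpha>"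
  have \<alpha>: "1 \<le> \<alpha>" unfolding \<alpha>_def using n by (rule nbhd_bound_ge_1)
  have "real (Max ((\<lambda>k. length (jacobi_algorithm (view M R k) t (snd (run jacobi_algorithm M b R \<epsilon> t k)))) ` {..<dim_row M}))
      \<le> ?B t" for t
  proof -
    let ?X = "(\<lambda>k. length (jacobi_algorithm (view M R k) t (snd (run jacobi_algorithm M b R \<epsilon> t k)))) ` {..<dim_row M}"
    have "Max ?X \<in> ?X" using n by (intro Max_in) (auto simp: lessThan_empty_iff)
    then obtain k where "Max ?X = length (jacobi_algorithm (view M R k) t (snd (run jacobi_algorithm M b R \<epsilon> t k)))"
      by auto
    then show ?thesis
      using round_length_le[OF n R, of k t "snd (run jacobi_algorithm M b R \<epsilon> t k)"]
      by (simp only: d_def \<alpha>_def)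
  qed
  then have "real (time_steps jacobi_algorithm M b R \<epsilon> (R + m)) \<le> (\<Sum>t<R + m. ?B t)"
    unfolding time_steps_def of_nat_sum by (intro sum_mono)
  also have "\<dots> = (\<Sum>t<R. ?B t) + (\<Sum>t=R..<R+m. ?B t)"
    unfolding lessThan_atLeast0 by (rule sum.atLeastLessThan_concat[symmetric]) simp_all
  also have "(\<Sum>t=R..<R+m. ?B t) = real m * (5 * \<alpha>)" using R by simp
  also have "(\<Sum>t<R. ?B t) \<le> (\<Sum>t<R. (if t = 0 then 4 + 2 * d else 0) + 9 * \<alpha> * d)"
    using \<alpha> by (intro sum_mono) (auto simp: d_def)
  also have "\<dots> = 4 + 2 * d + real R * (9 * \<alpha> * d)"
    using R by (simp add: sum.distrib)
  finally show ?thesis by simp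
qed

text \<open>The rounding up in the number of leaps and the first round are absorbed by the term \<open>\<alpha> R d\<close> if
  the graph has an edge, since \<open>ln (1 / \<epsilon>) \<ge> 1 / 2\<close>; without edges \<open>\<alpha> = 1\<close> and they are absorbed by
  the constant 1.\<close>

lemma time_steps_le_time_bound:
  fixes M :: "real mat"
  assumes n: "dim_row M \<ge> 1" and R: "R \<ge> 1" and eps: "0 < \<epsilon>" "\<epsilon> \<le> 1 / 2" and kpos: "cond_num M > 0"
  shows "real (time_steps jacobi_algorithm M b R \<epsilon> (R + nat \<lceil>cond_num M / real R * ln (1 / \<epsilon>)\<rceil>))
    \<le> 40 * max 1 (time_bound M R \<epsilon>)"
proof -
  define d \<alpha> L q m where "d = real (max_degree M)" and "\<alpha> = nbhd_bound (dim_row M) (max_degree M) R"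
    and "L = ln (1 / \<epsilon>)" and "q = cond_num M / real R * L" and "m = nat \<lceil>q\<rceil>"
  have \<alpha>: "1 \<le> \<alpha>" unfolding \<alpha>_def using n by (rule nbhd_bound_ge_1)
  have "ln 2 \<le> L" using eps unfolding L_def by (simp add: field_simps)
  then have L: "L \<ge> 1 / 2" using ln_le_minus_one[of "1 / 2 :: real"] by (simp add: ln_div)
  have q: "0 \<le> q" using kpos L by (simp add: q_def)
  then have m: "real m \<le> q + 1" unfolding m_def by linarith
  have tb: "time_bound M R \<epsilon> = \<alpha> * q + \<alpha> * real R * d * L"
    by (simp add: time_bound_def Let_def d_def \<alpha>_def q_def L_def algebra_simps)
  have steps: "real (time_steps jacobi_algorithm M b R \<epsilon> (R + m))
    \<le> 4 + 2 * d + real R * (9 * \<alpha> * d) + real m * (5 * \<alpha>)"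
    unfolding d_def \<alpha>_def using time_steps_le[OF n R] .
  also have "\<dots> \<le> 4 + 2 * d + real R * (9 * \<alpha> * d) + (q + 1) * (5 * \<alpha>)"
    using m \<alpha> by (intro add_left_mono mult_right_mono) auto
  also have "\<dots> \<le> 40 * max 1 (time_bound M R \<epsilon>)"
  proof (cases "max_degree M = 0")
    case True
    have "\<alpha> \<le> (0 ^ (R + 1) - 1) / (0 - 1)" unfolding \<alpha>_def nbhd_bound_def True by simp
    then have "\<alpha> = 1" using \<alpha> by simp
    then show ?thesis using True q tb by (simp add: d_def)
  next
    case False
    then have d: "1 \<le> d" by (simp add: d_def)
    define p where "p = \<alpha> * real R * d"
    have "1 * 1 \<le> \<alpha> * real R" using \<alpha> R by (intro mult_mono) auto
    moreover have "\<alpha> * 1 \<le> \<alpha> * real R" using \<alpha> R by (intro mult_left_mono) auto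
    moreover from calculation have "\<alpha> * real R * 1 \<le> \<alpha> * real R * d" "1 * d \<le> \<alpha> * real R * d"
      using d by (intro mult_left_mono mult_right_mono; simp)+
    ultimately have p: "\<alpha> \<le> p" "d \<le> p" "1 \<le> p" using d unfolding p_def by linarith+
    have "p * (1 / 2) \<le> p * L" using L p by (intro mult_left_mono) auto
    moreover have "0 \<le> \<alpha> * q" using \<alpha> q by simp
    ultimately have "4 + 2 * d + 9 * p + 5 * (\<alpha> * q) + 5 * \<alpha> \<le> 40 * (\<alpha> * q + p * L)"
      unfolding distrib_left using p by linarith
    moreover have "time_bound M R \<epsilon> = \<alpha> * q + p * L" by (simp add: tb p_def)
    moreover have "4 + 2 * d + real R * (9 * \<alpha> * d) + (q + 1) * (5 * \<alpha>)
        = 4 + 2 * d + 9 * p + 5 * (\<alpha> * q) + 5 * \<alpha>"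
      by (simp add: p_def algebra_simps)
    ultimately have "4 + 2 * d + real R * (9 * \<alpha> * d) + (q + 1) * (5 * \<alpha>) \<le> 40 * time_bound M R \<epsilon>"
      by (simp only:)
    also have "\<dots> \<le> 40 * max 1 (time_bound M R \<epsilon>)" by simp
    finally show ?thesis .
  qed
  finally show ?thesis by (simp add: m_def q_def L_def)
qed

theorem theorem2:
  shows "\<exists>(A :: algorithm) (rounds :: real \<Rightarrow> nat \<Rightarrow> real \<Rightarrow> nat) (C :: real).
    C > 0 \<and> only_R_hop A \<and>
    (\<forall>(n :: nat) (M\<^sub>0 :: real mat) (b\<^sub>0 :: real vec) (R :: nat) (\<epsilon> :: real).
       n \<ge> 1 \<longrightarrow> sddm n M\<^sub>0 \<longrightarrow> b\<^sub>0 \<in> carrier_vec n \<longrightarrow> R \<ge> 1 \<longrightarrow> 0 < \<epsilon> \<longrightarrow> \<epsilon> \<le> 1 / 2 \<longrightarrow>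
       (let N = rounds (cond_num M\<^sub>0) R \<epsilon>
        in approx_solution M\<^sub>0 b\<^sub>0 \<epsilon> (node_outputs A M\<^sub>0 b\<^sub>0 R \<epsilon> N) \<and>
           real (time_steps A M\<^sub>0 b\<^sub>0 R \<epsilon> N) \<le> C * max 1 (time_bound M\<^sub>0 R \<epsilon>)))"
proof (intro exI conjI allI impI)
  show "0 < (40 :: real)" by simp
  show "only_R_hop jacobi_algorithm" by (rule only_R_hop_jacobi_algorithm)
  fix n :: nat and M :: "real mat" and b :: "real vec" and R :: nat and \<epsilon> :: real
  assume n: "n \<ge> 1" and sd: "sddm n M" and b: "b \<in> carrier_vec n" and R: "R \<ge> 1"
    and eps: "0 < \<epsilon>" "\<epsilon> \<le> 1 / 2"
  \<comment> \<open>After \<open>m\<close> leaps the error has been multiplied by \<open>exp (- R m / \<kappa>) \<le> \<epsilon>\<close>.\<close>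
  define m where "m = nat \<lceil>cond_num M / real R * ln (1 / \<epsilon>)\<rceil>"
  have M: "M \<in> carrier_mat n n" using sd by (simp add: sddm_def)
  have kpos: "cond_num M > 0" by (rule sddm_diag_le_energy(1)[OF sd n])
  have out: "node_outputs jacobi_algorithm M b R \<epsilon> (R + m) = vec n (jacobi_iter M b (R * m))"
    using M run_leap_phase[OF sd R, of _ b \<epsilon> m] by (force simp: node_outputs_def)
  obtain x where x: "x \<in> carrier_vec n" "M *\<^sub>v x = b" using sddm_solvable[OF sd b] .
  have "exp (- real (R * m) / cond_num M) \<le> exp (- ln (1 / \<epsilon>))"
  proof -
    have "cond_num M / real R * ln (1 / \<epsilon>) \<le> real m" unfolding m_def by linarith
    then show ?thesis using R kpos by (simp add: field_simps)
  qed
  also have "\<dots> = \<epsilon>" using eps by (simp add: ln_div)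
  finally have "exp (- real (R * m) / cond_num M) \<le> \<epsilon>" .
  moreover have "energy_norm M x \<ge> 0"
    using sd x by (cases "x = 0\<^sub>v n") (auto simp: energy_norm_def sddm_def pos_def_def less_imp_le)
  ultimately have "energy_norm M (x - vec n (jacobi_iter M b (R * m))) \<le> \<epsilon> * energy_norm M x"
    using jacobi_error[OF sd n x, of "R * m"] by (meson mult_right_mono order_trans)
  then have "approx_solution M b \<epsilon> (node_outputs jacobi_algorithm M b R \<epsilon> (R + m))"
    unfolding approx_solution_def out using x M by auto
  moreover have "real (time_steps jacobi_algorithm M b R \<epsilon> (R + m)) \<le> 40 * max 1 (time_bound M R \<epsilon>)"
    unfolding m_def using M n R eps kpos by (intro time_steps_le_time_bound) auto
  ultimately show "let N = (\<lambda>\<kappa> R \<epsilon>. R + nat \<lceil>\<kappa> / real R * ln (1 / \<epsilon>)\<rceil>) (cond_num M) R \<epsilon>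
    in approx_solution M b \<epsilon> (node_outputs jacobi_algorithm M b R \<epsilon> N) \<and>
       real (time_steps jacobi_algorithm M b R \<epsilon> N) \<le> 40 * max 1 (time_bound M R \<epsilon>)"
    by (simp add: m_def)
qed

end
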